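(* Let $\omega^2+\omega+1=0$. The group $\Gamma=\mathrm{PSL}(2,\mathbb{Z}[\omega])$ has exactly two characters of Zariski-dense representations in $\mathrm{PSL}(2,\mathbb{C})$, namely the characters associated to the inclusion homomorphism and its complex conjugate. In particular, $\Gamma$ is Galois rigid.
   Context: A representation $\rho\colon\Gamma\to\mathrm{PSL}(2,\mathbb{C})$ is Zariski-dense if the preimage of its image in $\mathrm{SL}(2,\mathbb{C})$ is Zariski-dense in $\mathrm{SL}(2,\mathbb{C})$. The character of $\rho$ is the corresponding point of the $\mathrm{PSL}(2,\mathbb{C})$-character variety, i.e. the function $\gamma\mapsto\mathrm{tr}^2(\rho(\gamma))$; Zariski-dense representations have the same character if and only if they are conjugate in $\mathrm{PSL}(2,\mathbb{C})$. $\mathrm{X}_{\mathrm{zar}}(\Gamma,\mathbb{C})$ is the set of conjugacy classes of Zariski-dense representations $\Gamma\to\mathrm{PSL}(2,\mathbb{C})$. For a finitely generated subgroup $\Delta<\mathrm{PSL}(2,\mathbb{C})$ with preimage $\Delta_1<\mathrm{SL}(2,\mathbb{C})$, the trace-field is $K_\Delta=\mathbb{Q}(\mathrm{tr}(\delta):\delta\in\Delta_1)$. A finitely generated Zariski-dense subgroup $\Gamma<\mathrm{PSL}(2,\mathbb{C})$ whose trace-field is a number field is Galois rigid if $|\mathrm{X}_{\mathrm{zar}}(\Gamma,\mathbb{C})|=[K_\Gamma:\mathbb{Q}]$. *)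

theory Defs
  imports
    "HOL-Analysis.Analysis"
    "HOL-Algebra.Coset"
    "HOL-Algebra.Generated_Groups"
    "HOL-Algebra.Generated_Fields"
    "HOL-Algebra.Embedded_Algebras"
    "HOL-Algebra.Algebraic_Closure_Type"
begin

section \<open>The groups SL(2,R) and PSL(2,R) for a subring R of the complex numbers\<close>

definition SL2 :: "complex set \<Rightarrow> (complex^2^2) monoid" where
  "SL2 R = \<lparr>carrier = {A. (\<forall>i j. A $ i $ j \<in> R) \<and> det A = 1}, mult = (**), one = mat 1\<rparr>"

text \<open>
  An element of PSL(2,R) is a coset {A, -A}. Hence PSL(2,R) is literally contained in
  PSL(2,\<^term>\<open>UNIV\<close>), with the same multiplication and unit (see \<open>PSL2_eq\<close> below).
\<close>

definition PSL2 :: "complex set \<Rightarrow> (complex^2^2) set monoid" where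
  "PSL2 R = SL2 R Mod {mat 1, - mat 1}"

abbreviation SL2C :: "(complex^2^2) monoid" where "SL2C \<equiv> SL2 UNIV"
abbreviation PSL2C :: "(complex^2^2) set monoid" where "PSL2C \<equiv> PSL2 UNIV"

definition to_PSL2C :: "complex^2^2 \<Rightarrow> (complex^2^2) set" where
  "to_PSL2C A = {mat 1, - mat 1} #>\<^bsub>SL2C\<^esub> A"

definition SL2_preimage :: "(complex^2^2) set set \<Rightarrow> (complex^2^2) set" where
  "SL2_preimage \<Delta> = {A \<in> carrier SL2C. to_PSL2C A \<in> \<Delta>}"

text \<open>The ring Z[x] generated by a complex number x.\<close>

definition int_adjoin :: "complex \<Rightarrow> complex set" where
  "int_adjoin x = {poly p x | p. \<forall>i. Polynomial.coeff p i \<in> \<int>}"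


section \<open>The Zariski topology on SL(2,C)\<close>

inductive matrix_polynomial :: "(complex^2^2 \<Rightarrow> complex) \<Rightarrow> bool" where
  const: "matrix_polynomial (\<lambda>_. c)"
| entry: "matrix_polynomial (\<lambda>A. A $ i $ j)"
| add: "matrix_polynomial p \<Longrightarrow> matrix_polynomial q \<Longrightarrow> matrix_polynomial (\<lambda>A. p A + q A)"
| mult: "matrix_polynomial p \<Longrightarrow> matrix_polynomial q \<Longrightarrow> matrix_polynomial (\<lambda>A. p A * q A)"

definition zariski_closed :: "(complex^2^2) set \<Rightarrow> bool" where
  "zariski_closed Z \<longleftrightarrow>
     (\<exists>P. (\<forall>p\<in>P. matrix_polynomial p) \<and> Z = {A \<in> carrier SL2C. \<forall>p\<in>P. p A = 0})"

definition zariski_dense :: "(complex^2^2) set \<Rightarrow> bool" where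
  "zariski_dense S \<longleftrightarrow>
     S \<subseteq> carrier SL2C \<and> (\<forall>Z. zariski_closed Z \<and> S \<subseteq> Z \<longrightarrow> Z = carrier SL2C)"


section \<open>Zariski-dense representations and their characters\<close>

text \<open>
  Representations are extensional, i.e. \<^term>\<open>undefined\<close> outside the group, so that they are
  determined by their values on the group and can be counted.
\<close>

definition zar_reps :: "('g, 'm) monoid_scheme \<Rightarrow> ('g \<Rightarrow> (complex^2^2) set) set" where
  "zar_reps G =
     {\<rho> \<in> hom G PSL2C \<inter> extensional (carrier G). zariski_dense (SL2_preimage (\<rho> ` carrier G))}"

text \<open>
  \<open>sq_trace\<close> is the function tr^2 on PSL(2,C): both representatives of a coset {A, -A} have the
  same squared trace (see \<open>sq_trace_to_PSL2C\<close> below).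
\<close>

definition sq_trace :: "(complex^2^2) set \<Rightarrow> complex" where
  "sq_trace C = (THE t. \<exists>A\<in>C. t = (trace A)\<^sup>2)"

definition character ::
    "('g, 'm) monoid_scheme \<Rightarrow> ('g \<Rightarrow> (complex^2^2) set) \<Rightarrow> 'g \<Rightarrow> complex" where
  "character G \<rho> = (\<lambda>\<gamma>\<in>carrier G. sq_trace (\<rho> \<gamma>))"

definition conjugacy_class ::
    "('g, 'm) monoid_scheme \<Rightarrow> ('g \<Rightarrow> (complex^2^2) set) \<Rightarrow> ('g \<Rightarrow> (complex^2^2) set) set" where
  "conjugacy_class G \<rho> =
     (\<lambda>g. \<lambda>\<gamma>\<in>carrier G. g \<otimes>\<^bsub>PSL2C\<^esub> \<rho> \<gamma> \<otimes>\<^bsub>PSL2C\<^esub> inv\<^bsub>PSL2C\<^esub> g) ` carrier PSL2C"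

definition X_zar :: "('g, 'm) monoid_scheme \<Rightarrow> ('g \<Rightarrow> (complex^2^2) set) set set" where
  "X_zar G = conjugacy_class G ` zar_reps G"

definition complex_conjugate ::
    "('g, 'm) monoid_scheme \<Rightarrow> ('g \<Rightarrow> (complex^2^2) set) \<Rightarrow> 'g \<Rightarrow> (complex^2^2) set" where
  "complex_conjugate G \<rho> = (\<lambda>\<gamma>\<in>carrier G. (\<lambda>A. \<chi> i j. cnj (A $ i $ j)) ` \<rho> \<gamma>)"


section \<open>Trace fields and Galois rigidity\<close>

abbreviation complex_ring :: "complex ring" where
  "complex_ring \<equiv> ring_of_type_algebra"

text \<open>
  The subfield generated by the traces automatically contains the rationals, as the
  characteristic is 0.
\<close>

definition trace_field :: "(complex^2^2) set set \<Rightarrow> complex set" where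
  "trace_field \<Delta> = generate_field complex_ring (trace ` SL2_preimage \<Delta>)"

definition number_field :: "complex set \<Rightarrow> bool" where
  "number_field K \<longleftrightarrow> subfield K complex_ring \<and> ring.finite_dimension complex_ring \<rat> K"

definition field_degree :: "complex set \<Rightarrow> nat" where
  "field_degree K = ring.dim complex_ring \<rat> K"

text \<open>
  The requirement that \<^term>\<open>X_zar\<close> be finite excludes the convention that infinite sets have
  cardinality 0.
\<close>

definition galois_rigid :: "(complex^2^2) set set \<Rightarrow> bool" where
  "galois_rigid \<Gamma> \<longleftrightarrow>
     subgroup \<Gamma> PSL2C \<and>
     (\<exists>S. finite S \<and> S \<subseteq> \<Gamma> \<and> generate PSL2C S = \<Gamma>) \<and>
     zariski_dense (SL2_preimage \<Gamma>) \<and>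
     number_field (trace_field \<Gamma>) \<and>
     finite (X_zar (PSL2C\<lparr>carrier := \<Gamma>\<rparr>)) \<and>
     card (X_zar (PSL2C\<lparr>carrier := \<Gamma>\<rparr>)) = field_degree (trace_field \<Gamma>)"


section \<open>Well-formedness\<close>

lemma adjugate_mult: 
  fixes A :: "complex^2^2"
  shows "(\<chi> i j. if i = j then (if i = 1 then A$2$2 else A$1$1) else - A$i$j) ** A = mat (det A)"
  by (simp add: vec_eq_iff forall_2 matrix_matrix_mult_def mat_def sum_2 det_2 algebra_simps)

lemma group_SL2C: "group SL2C"
proof (rule groupI)
  fix A :: "complex^2^2" assume A: "A \<in> carrier SL2C"
  define B where
    "B = (\<chi> i j. if i = j then (if i = 1 then A$2$2 else A$1$1) else - A$i$j :: complex^2^2)"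
  have "B ** A = mat 1"
    using adjugate_mult[of A] A by (simp add: B_def SL2_def)
  moreover have "det B = 1"
    using A by (simp add: B_def SL2_def det_2 mult.commute)
  ultimately show "\<exists>B\<in>carrier SL2C. B \<otimes>\<^bsub>SL2C\<^esub> A = \<one>\<^bsub>SL2C\<^esub>"
    by (intro bexI[of _ B]) (auto simp: SL2_def)
qed (auto simp: SL2_def det_mul matrix_mul_assoc)

lemma to_PSL2C_eq: "to_PSL2C A = {A, - A}"
proof -
  have "(- mat 1) ** A = - A"
    by (simp add: vec_eq_iff matrix_matrix_mult_def mat_def sum_negf if_distrib if_distribR sum.delta cong: if_cong)
  thus ?thesis by (auto simp: to_PSL2C_def r_coset_def SL2_def)
qed

lemma normal_pm1: "{mat 1, - mat 1} \<lhd> SL2C"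
proof -
  interpret group SL2C by (rule group_SL2C)
  have neg: "(- A) ** B = - (A ** B)" "A ** (- B) = - (A ** B)" for A B :: "complex^2^2"
    by (simp_all add: vec_eq_iff matrix_matrix_mult_def sum_negf)
  have one: "\<one>\<^bsub>SL2C\<^esub> = mat 1" and mult: "A \<otimes>\<^bsub>SL2C\<^esub> B = A ** B" for A B
    by (simp_all add: SL2_def)
  have m: "- mat 1 \<in> carrier SL2C" "mat 1 \<in> carrier SL2C"
    by (simp_all add: SL2_def det_2 mat_def)
  have "inv\<^bsub>SL2C\<^esub> (- mat 1) = - mat 1"
    by (rule inv_equality) (use m in \<open>simp_all add: one mult neg\<close>)
  moreover have "inv\<^bsub>SL2C\<^esub> (mat 1) = mat 1"
    using inv_one by (simp add: one)
  ultimately have "subgroup {mat 1, - mat 1} SL2C"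
    by (intro subgroupI) (use m in \<open>auto simp: mult neg\<close>)
  moreover have "A <#\<^bsub>SL2C\<^esub> {mat 1, - mat 1} = {mat 1, - mat 1} #>\<^bsub>SL2C\<^esub> A" for A
    by (auto simp: l_coset_def r_coset_def mult neg)
  ultimately show ?thesis by (auto intro!: normalI)
qed

lemma group_PSL2C: "group PSL2C"
  unfolding PSL2_def by (rule normal.factorgroup_is_group[OF normal_pm1])

lemma PSL2_eq: "PSL2 R = PSL2C\<lparr>carrier := to_PSL2C ` carrier (SL2 R)\<rparr>"
  by (auto simp: PSL2_def FactGroup_def RCOSETS_def to_PSL2C_def r_coset_def SL2_def
      set_mult_def fun_eq_iff)

lemma sq_trace_to_PSL2C: "sq_trace (to_PSL2C A) = (trace A)\<^sup>2"
proof -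
  have "trace (- A) = - trace A" by (simp add: trace_def sum_negf)
  thus ?thesis by (auto simp: sq_trace_def to_PSL2C_eq)
qed

end

theory Submission
  imports Defs
begin

text \<open>
  Let $S$, $T$, $D$ be the classes of $(0,-1;1,0)$, $(1,1;0,1)$ and
  $\mathrm{diag}(\omega,\omega^2)$. The Euclidean algorithm in $\mathbb{Z}[\omega]$ shows that
  they generate $\Gamma$, so a representation $\rho$ is determined by their images. If $\rho(D)$
  is trivial, then $\rho(T)^3 = 1$. Otherwise an eigenvector $v$ of $\rho(D)$ together with
  $\rho(S) v$ is a basis in which $S$ and $D$ act as they stand, and the relations that $T$
  commutes with $D T D^{-1}$ and that $(ST)^3 = 1$ leave two possibilities: either
  $\rho(T)$ is upper or lower triangular, which gives the inclusion and its conjugate, or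
  $\rho(T)^2 = 1$.

  The two cases in which $\rho(T)$ has finite order come from the quotients $A_4$ and $A_5$ of
  $\Gamma$. There every elementary matrix has the same image as one whose entry is $0$ or a unit,
  and as $S E(u) S$ lies in $B S B$ for units $u$, where $B$ is the upper triangular subgroup, a
  Bruhat decomposition shows that the image of $\rho$ is finite and thus not Zariski-dense.
\<close>

unbundle no fps_syntax

section \<open>Two by two matrices\<close>

text \<open>The two finite cases are governed by residue fields. Reduction modulo 1 - \<omega> sends
  Z[\<omega>] onto the field with three elements and kills the class of D, since \<omega> becomes 1;
  reduction modulo 2 leads to the field with four elements and kills T^2. In both fields every class
  is represented by 0 or by a unit of Z[\<omega>], which is what the Bruhat argument requires.
  PSL(2,3) and PSL(2,4) are the groups A_4 and A_5.

  The recurring obstacle is signs: a relation in PSL holds for lifts to SL only up to sign. For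
  elements of order two or three, Cayley-Hamilton turns such a relation into a condition on the
  trace. Likewise the lifts of T and of its conjugate by D either commute, which makes them
  triangular, or anticommute, which forces trace 0.

  The eigenvector basis works because S and SD both have order two: S inverts D and so exchanges the
  two eigenlines of D. Complex conjugation enters for the same reason. It inverts D, conjugation by
  S inverts D again, and the composite fixes the classes of S and D while turning T into a lower
  triangular class.\<close>

definition mat2 :: "'a \<Rightarrow> 'a \<Rightarrow> 'a \<Rightarrow> 'a \<Rightarrow> 'a^2^2" where
  "mat2 a b c d = (\<chi> i j. if i = 1 then (if j = 1 then a else b) else (if j = 1 then c else d))"

lemma mat2_nth [simp]:
  "mat2 a b c d $ 1 $ 1 = a" "mat2 a b c d $ 1 $ 2 = b"
  "mat2 a b c d $ 2 $ 1 = c" "mat2 a b c d $ 2 $ 2 = d"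
  by (simp_all add: mat2_def)

lemma mat2_collapse: "mat2 (A $ 1 $ 1) (A $ 1 $ 2) (A $ 2 $ 1) (A $ 2 $ 2) = A"
  by (simp add: vec_eq_iff forall_2)

lemma mat2_cases: obtains a b c d where "A = mat2 a b c d"
  by (metis mat2_collapse)

lemma mat2_eq_iff [simp]:
  "mat2 a b c d = mat2 a' b' c' d' \<longleftrightarrow> a = a' \<and> b = b' \<and> c = c' \<and> d = d'"
  by (metis mat2_nth)

lemma mat2_mult [simp]:
  "mat2 a b c d ** mat2 a' b' c' d' =
     mat2 (a * a' + b * c') (a * b' + b * d') (c * a' + d * c') (c * b' + d * d' :: complex)"
  by (simp add: vec_eq_iff forall_2 matrix_matrix_mult_def sum_2)

lemma det_mat2 [simp]: "det (mat2 a b c d :: complex^2^2) = a * d - b * c"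
  by (simp add: det_2)

lemma trace_mat2 [simp]: "trace (mat2 a b c d :: complex^2^2) = a + d"
  by (simp add: trace_def sum_2)

lemma mat_eq_mat2: "mat x = (mat2 x 0 0 x :: complex^2^2)"
  by (simp add: vec_eq_iff forall_2 mat_def)

lemma uminus_mat2 [simp]: "- mat2 a b c d = (mat2 (- a) (- b) (- c) (- d) :: complex^2^2)"
  by (simp add: vec_eq_iff forall_2)

text \<open>The adjugate is the inverse on SL(2,C) but polynomial in the entries, so conjugation
  \<open>g ** A ** adj2 g\<close> involves no division.\<close>

definition adj2 :: "complex^2^2 \<Rightarrow> complex^2^2" where
  "adj2 A = mat2 (A $ 2 $ 2) (- A $ 1 $ 2) (- A $ 2 $ 1) (A $ 1 $ 1)"

lemma adj2_mat2 [simp]: "adj2 (mat2 a b c d) = mat2 d (- b) (- c) a"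
  by (simp add: adj2_def)

lemma
  assumes "det A = 1"
  shows adj2_mult: "adj2 A ** A = mat 1" and mult_adj2: "A ** adj2 A = mat 1"
  using assms by (cases A rule: mat2_cases; simp add: mat_eq_mat2 algebra_simps)+

lemma det_adj2 [simp]: "det (adj2 A) = det A"
  by (cases A rule: mat2_cases) (simp add: algebra_simps)

lemma trace_conj:
  assumes "det g = 1"
  shows "trace (g ** A ** adj2 g) = trace (A :: complex^2^2)"
proof -
  obtain p q r s where g: "g = mat2 p q r s" by (rule mat2_cases)
  obtain a b c d where A: "A = mat2 a b c d" by (rule mat2_cases)
  have "trace (g ** A ** adj2 g) = (p * s - q * r) * trace A"
    by (simp add: g A algebra_simps)
  then show ?thesis using assms by (simp add: g)
qed

definition cnj_mat :: "complex^2^2 \<Rightarrow> complex^2^2" where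
  "cnj_mat A = (\<chi> i j. cnj (A $ i $ j))"

lemma cnj_mat_mat2 [simp]: "cnj_mat (mat2 a b c d) = mat2 (cnj a) (cnj b) (cnj c) (cnj d)"
  by (simp add: cnj_mat_def vec_eq_iff forall_2)

lemma cnj_mat_mult: "cnj_mat (A ** B) = cnj_mat A ** cnj_mat B"
  by (simp add: cnj_mat_def vec_eq_iff matrix_matrix_mult_def)

lemma det_cnj_mat: "det (cnj_mat A) = cnj (det A)"
  by (cases A rule: mat2_cases) simp

lemma cnj_mat_minus: "cnj_mat (- A) = - cnj_mat A"
  by (simp add: cnj_mat_def vec_eq_iff)

lemma cnj_mat_cnj_mat [simp]: "cnj_mat (cnj_mat A) = A"
  by (simp add: cnj_mat_def vec_eq_iff)

lemma minus_matrix_mult: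
  fixes A B :: "complex^2^2"
  shows "(- A) ** B = - (A ** B)" "A ** (- B) = - (A ** B)"
  by (simp_all add: vec_eq_iff matrix_matrix_mult_def sum_negf)

abbreviation (input) "matS \<equiv> mat2 0 (-1) 1 (0 :: complex)"

abbreviation (input) "upper x \<equiv> mat2 1 x 0 (1 :: complex)"

abbreviation (input) "lower x \<equiv> mat2 1 0 x (1 :: complex)"


section \<open>The group PSL(2,C)\<close>

lemma carrier_SL2: "carrier (SL2 R) = {A. (\<forall>i j. A $ i $ j \<in> R) \<and> det A = 1}"
  by (simp add: SL2_def)

lemma mat2_in_SL2 [simp]:
  "mat2 a b c d \<in> carrier (SL2 R) \<longleftrightarrow>
     a \<in> R \<and> b \<in> R \<and> c \<in> R \<and> d \<in> R \<and> a * d - b * c = 1"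
  by (auto simp: carrier_SL2 forall_2)

lemma in_SL2C [simp]: "A \<in> carrier SL2C \<longleftrightarrow> det A = 1"
  by (simp add: carrier_SL2)

lemma SL2_mult [simp]: "A \<otimes>\<^bsub>SL2 R\<^esub> B = A ** B" and SL2_one [simp]: "\<one>\<^bsub>SL2 R\<^esub> = mat 1"
  by (simp_all add: SL2_def)

lemma PSL2_carrier: "carrier (PSL2 R) = to_PSL2C ` carrier (SL2 R)"
  by (subst PSL2_eq) simp

lemma to_PSL2C_mult: "to_PSL2C A \<otimes>\<^bsub>PSL2 R\<^esub> to_PSL2C B = to_PSL2C (A ** B)"
proof -
  have "to_PSL2C A \<otimes>\<^bsub>PSL2 R\<^esub> to_PSL2C B = {A ** B, A ** (- B), (- A) ** B, (- A) ** (- B)}"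
    by (subst PSL2_eq) (simp add: PSL2_def FactGroup_def set_mult_def to_PSL2C_eq, blast)
  then show ?thesis by (auto simp: to_PSL2C_eq minus_matrix_mult)
qed

lemma to_PSL2C_one: "\<one>\<^bsub>PSL2 R\<^esub> = to_PSL2C (mat 1)"
  by (subst PSL2_eq) (simp add: PSL2_def FactGroup_def to_PSL2C_eq)

lemma to_PSL2C_eq_iff: "to_PSL2C A = to_PSL2C B \<longleftrightarrow> A = B \<or> A = - B"
  by (auto simp: to_PSL2C_eq doubleton_eq_iff)

lemma to_PSL2C_minus [simp]: "to_PSL2C (- A) = to_PSL2C A"
  by (auto simp: to_PSL2C_eq)

lemma to_PSL2C_inv:
  assumes "det A = 1"
  shows "inv\<^bsub>PSL2C\<^esub> (to_PSL2C A) = to_PSL2C (adj2 A)"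
  using assms
  by (intro group.inv_equality[OF group_PSL2C])
    (auto simp: to_PSL2C_mult to_PSL2C_one adj2_mult PSL2_carrier)

lemma PSL2C_cases:
  assumes "x \<in> carrier PSL2C"
  obtains A where "det A = 1" "x = to_PSL2C A"
  using assms by (auto simp: PSL2_carrier)

text \<open>Every class has two lifts, A and -A; closure of \<open>R\<close> under negation keeps
  the second one in \<open>SL2 R\<close>.\<close>

lemma SL2_preimage_PSL2:
  assumes "\<And>x. x \<in> R \<Longrightarrow> - x \<in> R"
  shows "SL2_preimage (carrier (PSL2 R)) = carrier (SL2 R)"
proof -
  have neg: "- A \<in> carrier (SL2 R)" if "A \<in> carrier (SL2 R)" for A
    using that assms by (cases A rule: mat2_cases) simp
  have "carrier (SL2 R) \<subseteq> carrier SL2C" by (auto simp: carrier_SL2)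
  then show ?thesis
    by (auto simp: SL2_preimage_def PSL2_carrier to_PSL2C_eq_iff simp del: in_SL2C intro: neg)
qed


section \<open>Zariski density\<close>

text \<open>Along this line every matrix entry is affine in \<open>x\<close>, so sums and products
  of entries are polynomials in one variable.\<close>

lemma matrix_polynomial_along_upper:
  fixes A B :: "complex^2^2"
  assumes "matrix_polynomial p"
  shows "\<exists>q. \<forall>x. p (A ** upper x ** B) = poly q x"
  using assms
proof (induction rule: matrix_polynomial.induct)
  case (const c)
  show ?case by (rule exI[of _ "[:c:]"]) simp
next
  case (entry i j)
  have "(A ** upper x ** B) $ i $ j =
      poly [:A$i$1 * B$1$j + A$i$2 * B$2$j, A$i$1 * B$2$j:] x" for x
    by (simp add: matrix_matrix_mult_def sum_2 algebra_simps)
  then show ?case by (intro exI allI)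
next
  case (add p q)
  then obtain f g where "\<And>x. p (A ** upper x ** B) = poly f x" "\<And>x. q (A ** upper x ** B) = poly g x"
    by blast
  then show ?case by (intro exI[of _ "f + g"]) simp
next
  case (mult p q)
  then obtain f g where "\<And>x. p (A ** upper x ** B) = poly f x" "\<And>x. q (A ** upper x ** B) = poly g x"
    by blast
  then show ?case by (intro exI[of _ "f * g"]) simp
qed

lemma poly_zero_if_zero_on_Ints:
  fixes q :: "complex poly"
  assumes "\<And>n. poly q (of_int n) = 0"
  shows "q = 0"
proof (rule ccontr)
  assume "q \<noteq> 0"
  then have "finite {x. poly q x = 0}" by (rule poly_roots_finite)
  moreover have "range (of_int :: int \<Rightarrow> complex) \<subseteq> {x. poly q x = 0}" using assms by auto
  moreover have "infinite (range (of_int :: int \<Rightarrow> complex))"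
    by (simp add: finite_image_iff inj_on_def)
  ultimately show False by (metis finite_subset)
qed

text \<open>Infinitely many zeros kill a one-variable polynomial: the integer points are
  Zariski-dense in a two-sided translate of the unipotent group.\<close>

lemma matrix_polynomial_zero_upper:
  assumes "matrix_polynomial p" "\<And>n. p (A ** upper (of_int n) ** B) = 0"
  shows "p (A ** upper x ** B) = 0"
  by (metis assms matrix_polynomial_along_upper poly_zero_if_zero_on_Ints poly_0)

text \<open>Conjugation by \<open>matS\<close>, whose inverse is \<open>- matS\<close>, exchanges
  the two unipotent groups and so transfers the vanishing result to \<open>lower\<close>.\<close>

lemma lower_eq_conj_upper: "(A :: complex^2^2) ** lower x ** B = (A ** matS) ** upper (- x) ** (- matS ** (B :: complex^2^2))"
  by (cases A rule: mat2_cases; cases B rule: mat2_cases) (simp add: algebra_simps)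

lemma matrix_polynomial_zero_lower:
  assumes "matrix_polynomial p" "\<And>n. p (A ** lower (of_int n) ** B) = 0"
  shows "p (A ** lower x ** B) = 0"
proof -
  have "p ((A ** matS) ** upper (of_int n) ** (- matS ** B)) = 0" for n
    using assms(2)[of "- n"] by (simp only: lower_eq_conj_upper) simp
  from matrix_polynomial_zero_upper[OF assms(1) this] show ?thesis
    unfolding lower_eq_conj_upper .
qed

text \<open>If the lower left entry c is nonzero, a row and a column operation turn both diagonal
  entries into 1, and by the determinant only \<open>lower c\<close> remains. If c = 0, then d is
  nonzero, and adding the second column to the first leads back to that case at the cost of a fourth
  factor.\<close>

lemma elementary_decomposition:
  assumes "det (A :: complex^2^2) = 1"
  obtains x y z w where "A = upper x ** lower y ** upper z ** lower w"
proof -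
  obtain a b c d where A: "A = mat2 a b c d" by (rule mat2_cases)
  have det: "a * d - b * c = 1" using assms by (simp add: A)
  have *: "\<exists>x y z. mat2 a b c d = upper x ** lower y ** upper z"
    if "c \<noteq> 0" "a * d - b * c = 1" for a b c d :: complex
  proof -
    have "b = (a * d - 1) / c" using that by (simp add: field_simps)
    then have "mat2 a b c d = upper ((a - 1) / c) ** lower c ** upper ((d - 1) / c)"
      using that(1) by (simp add: field_simps)
    then show ?thesis by blast
  qed
  show thesis
  proof (cases "c = 0")
    case False
    then obtain x y z where "A = upper x ** lower y ** upper z" using * det A by blast
    then show ?thesis by (intro that[of x y z 0]) simp
  next
    case True
    then have "c + d \<noteq> 0" "(a + b) * d - b * (c + d) = 1" using det by (auto simp: algebra_simps)
    then obtain x y z where "mat2 (a + b) b (c + d) d = upper x ** lower y ** upper z"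
      using * by blast
    moreover have "A = mat2 (a + b) b (c + d) d ** lower (- 1)" by (simp add: A)
    ultimately show ?thesis using that by metis
  qed
qed

text \<open>Four elementary factors exhaust SL(2,C), and with integer parameters they lie in
  SL(2,Z). The parameters are freed from integer to complex values one at a time, with the other
  three held fixed.\<close>

lemma zariski_dense_if_contains_SL2Z:
  assumes "S \<subseteq> carrier SL2C" "carrier (SL2 \<int>) \<subseteq> S"
  shows "zariski_dense S"
  unfolding zariski_dense_def
proof (intro conjI allI impI)
  fix Z assume "zariski_closed Z \<and> S \<subseteq> Z"
  then obtain P where P: "\<And>p. p \<in> P \<Longrightarrow> matrix_polynomial p"
      "Z = {A \<in> carrier SL2C. \<forall>p\<in>P. p A = 0}" and SZ: "S \<subseteq> Z"
    unfolding zariski_closed_def by blast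
  have "p A = 0" if p: "p \<in> P" and A: "det A = 1" for p A
  proof -
    note up = matrix_polynomial_zero_upper[OF P(1)[OF p]]
    note lo = matrix_polynomial_zero_lower[OF P(1)[OF p]]
    have 0: "p (upper (of_int k) ** lower (of_int l) ** upper (of_int m) ** lower (of_int n)) = 0"
      for k l m n
    proof -
      have "upper (of_int k) ** lower (of_int l) ** upper (of_int m) ** lower (of_int n)
          \<in> carrier (SL2 \<int>)"
        by (simp add: algebra_simps)
      with assms(2) SZ P(2) p show ?thesis by blast
    qed
    have 1: "p (upper x ** lower (of_int l) ** upper (of_int m) ** lower (of_int n)) = 0" for x l m n
      using up[of "mat 1" "lower (of_int l) ** upper (of_int m) ** lower (of_int n)" x] 0
      by (simp add: matrix_mul_assoc del: mat2_mult)
    have 2: "p (upper x ** lower y ** upper (of_int m) ** lower (of_int n)) = 0" for x y m n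
      using lo[of "upper x" "upper (of_int m) ** lower (of_int n)" y] 1
      by (simp add: matrix_mul_assoc del: mat2_mult)
    have 3: "p (upper x ** lower y ** upper z ** lower (of_int n)) = 0" for x y z n
      using up[of "upper x ** lower y" "lower (of_int n)" z] 2
      by (simp add: matrix_mul_assoc del: mat2_mult)
    have "p (upper x ** lower y ** upper z ** lower w) = 0" for x y z w
      using lo[of "upper x ** lower y ** upper z" "mat 1" w] 3
      by (simp add: matrix_mul_assoc del: mat2_mult)
    then show ?thesis using elementary_decomposition[OF A] by metis
  qed
  then show "Z = carrier SL2C" using P(2) by auto
qed (rule assms(1))

lemma matrix_polynomial_prod:
  assumes "finite H" "\<And>h. h \<in> H \<Longrightarrow> matrix_polynomial (p h)"
  shows "matrix_polynomial (\<lambda>A. \<Prod>h\<in>H. p h A)"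
  using assms by (induction rule: finite_induct) (auto intro: matrix_polynomial.intros)

text \<open>The product of \<open>trace A - trace h\<close> over all \<open>h\<close> in
  \<open>S\<close> vanishes on \<open>S\<close>, but the trace takes every complex value on SL(2,C),
  as the companion matrices \<open>mat2 x (-1) 1 0\<close> show.\<close>

lemma finite_not_zariski_dense:
  assumes "finite S"
  shows "\<not> zariski_dense S"
proof
  assume dense: "zariski_dense S"
  define p where "p = (\<lambda>A :: complex^2^2. \<Prod>h\<in>S. trace A + - trace h)"
  have "matrix_polynomial (\<lambda>A. trace A + - trace h)" for h
    unfolding trace_def sum_2
    by (intro matrix_polynomial.add matrix_polynomial.entry matrix_polynomial.const)
  then have "matrix_polynomial p"
    unfolding p_def by (rule matrix_polynomial_prod[OF assms])
  then have "zariski_closed {A \<in> carrier SL2C. p A = 0}"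
    unfolding zariski_closed_def by (intro exI[of _ "{p}"]) simp
  moreover have "S \<subseteq> {A \<in> carrier SL2C. p A = 0}"
    using dense assms by (simp add: zariski_dense_def p_def prod_zero_iff subset_iff) blast
  ultimately have "{A \<in> carrier SL2C. p A = 0} = carrier SL2C"
    using dense unfolding zariski_dense_def by blast
  moreover have "mat2 x (-1) 1 0 \<in> carrier SL2C" for x by simp
  ultimately have "p (mat2 x (-1) 1 0) = 0" for x by blast
  then have "x \<in> trace ` S" for x
    using assms by (simp add: p_def image_iff add_eq_0_iff)
  then have "finite (UNIV :: complex set)"
    using assms by (metis UNIV_eq_I finite_imageI)
  then show False using infinite_UNIV_char_0 by blast
qed

lemma finite_image_not_zariski_dense:
  assumes "finite \<Delta>" "\<Delta> \<subseteq> carrier PSL2C"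
  shows "\<not> zariski_dense (SL2_preimage \<Delta>)"
proof (rule finite_not_zariski_dense)
  have "A \<in> to_PSL2C A" for A by (simp add: to_PSL2C_eq)
  then have "SL2_preimage \<Delta> \<subseteq> \<Union>\<Delta>" unfolding SL2_preimage_def by blast
  moreover have "finite C" if "C \<in> \<Delta>" for C
  proof -
    have "C \<in> carrier PSL2C" using that assms(2) by blast
    then show ?thesis by (metis PSL2C_cases to_PSL2C_eq finite.emptyI finite_insert)
  qed
  then have "finite (\<Union>\<Delta>)" using assms(1) by blast
  ultimately show "finite (SL2_preimage \<Delta>)" by (rule finite_subset)
qed

section \<open>The Eisenstein integers\<close>

locale eisenstein =
  fixes \<omega> :: complex
  assumes omega_eq: "\<omega>\<^sup>2 + \<omega> + 1 = 0"
begin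

abbreviation R where "R \<equiv> int_adjoin \<omega>"

lemma omega_sq: "\<omega> * \<omega> = - 1 - \<omega>"
  using omega_eq by (simp add: power2_eq_square algebra_simps eq_neg_iff_add_eq_0)

text \<open>The quadratic relation inside a right-nested product; together with
  \<open>omega_sq\<close> it reduces every polynomial in \<omega> to the form a + b
  \<omega>.\<close>

lemma omega_sq_mult: "\<omega> * (\<omega> * x) = - x - \<omega> * x"
  unfolding mult.assoc[symmetric] omega_sq by (simp add: algebra_simps)

text \<open>Either root of the quadratic is allowed, so only the square of
  \<open>Im \<omega>\<close> is determined.\<close>

lemma Re_omega: "Re \<omega> = - 1 / 2" and Im_omega_sq: "Im \<omega> * Im \<omega> = 3 / 4"
proof -
  have re: "Re \<omega> * Re \<omega> - Im \<omega> * Im \<omega> = - 1 - Re \<omega>" and im: "2 * (Re \<omega> * Im \<omega>) = - Im \<omega>"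
    using arg_cong[OF omega_sq, of Re] arg_cong[OF omega_sq, of Im] by (simp_all add: mult.commute)
  have "Im \<omega> \<noteq> 0"
  proof
    assume "Im \<omega> = 0"
    then have "(Re \<omega> + 1 / 2) * (Re \<omega> + 1 / 2) = - 3 / 4" using re by (simp add: algebra_simps)
    then show False using zero_le_square[of "Re \<omega> + 1 / 2"] by simp
  qed
  moreover have "Im \<omega> * (2 * Re \<omega> + 1) = 0" using im by (simp add: algebra_simps)
  ultimately show *: "Re \<omega> = - 1 / 2" by simp
  show "Im \<omega> * Im \<omega> = 3 / 4" using re unfolding * by simp
qed

lemma Im_omega_nonzero: "Im \<omega> \<noteq> 0"
  using Im_omega_sq by auto

lemma cnj_omega: "cnj \<omega> = - 1 - \<omega>"
  by (simp add: complex_eq_iff Re_omega)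

lemma omega_not_0: "\<omega> \<noteq> 0"
  using Im_omega_nonzero by auto

lemma int_adjoin_omega: "x \<in> R \<longleftrightarrow> (\<exists>a b. x = of_int a + of_int b * \<omega>)"
proof
  assume "x \<in> R"
  then obtain p where p: "\<forall>i. poly.coeff p i \<in> \<int>" "x = poly p \<omega>"
    by (auto simp: int_adjoin_def)
  have "\<exists>a b. poly p \<omega> = of_int a + of_int b * \<omega>"
    using p(1)
  proof (induction p)
    case 0
    show ?case by (rule exI[of _ 0], rule exI[of _ 0]) simp
  next
    case (pCons c p)
    have "c \<in> \<int>" using pCons.prems[rule_format, of 0] by simp
    then obtain k where k: "c = of_int k" by (auto elim: Ints_cases)
    have "\<forall>i. poly.coeff p i \<in> \<int>"
      using pCons.prems[rule_format, of "Suc _"] by simp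
    then obtain a b where "poly p \<omega> = of_int a + of_int b * \<omega>" using pCons.IH by blast
    then have "poly (pCons c p) \<omega> = of_int (k - b) + of_int (a - b) * \<omega>"
      by (simp add: k algebra_simps omega_sq_mult omega_sq)
    then show ?case by blast
  qed
  then show "\<exists>a b. x = of_int a + of_int b * \<omega>" by (simp add: p(2))
next
  assume "\<exists>a b. x = of_int a + of_int b * \<omega>"
  then obtain a b where x: "x = of_int a + of_int b * \<omega>" by blast
  have "\<forall>i. poly.coeff [:of_int a, of_int b :: complex:] i \<in> \<int>"
    by (simp add: coeff_pCons split: nat.splits)
  moreover have "x = poly [:of_int a, of_int b:] \<omega>" by (simp add: x)
  ultimately show "x \<in> R" unfolding int_adjoin_def by blast
qed

lemma R_I: "of_int a + of_int b * \<omega> \<in> R"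
  using int_adjoin_omega by blast

lemma R_cases:
  assumes "x \<in> R"
  obtains a b where "x = of_int a + of_int b * \<omega>"
  using assms int_adjoin_omega by blast

lemma R_of_int [simp, intro]: "of_int a \<in> R"
  using R_I[of a 0] by simp

lemma R_omega [simp, intro]: "\<omega> \<in> R"
  using R_I[of 0 1] by simp

lemma R_0 [simp, intro]: "0 \<in> R" and R_1 [simp, intro]: "1 \<in> R"
  using R_of_int[of 0] R_of_int[of 1] by simp_all

lemma R_add [simp, intro]: "x \<in> R \<Longrightarrow> y \<in> R \<Longrightarrow> x + y \<in> R"
proof (elim R_cases)
  fix a b c d assume "x = of_int a + of_int b * \<omega>" "y = of_int c + of_int d * \<omega>"
  then have "x + y = of_int (a + c) + of_int (b + d) * \<omega>" by (simp add: algebra_simps)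
  then show ?thesis using R_I by metis
qed

lemma R_mult [simp, intro]: "x \<in> R \<Longrightarrow> y \<in> R \<Longrightarrow> x * y \<in> R"
proof (elim R_cases)
  fix a b c d assume "x = of_int a + of_int b * \<omega>" "y = of_int c + of_int d * \<omega>"
  then have "x * y = of_int (a * c - b * d) + of_int (a * d + b * c - b * d) * \<omega>"
    by (simp add: algebra_simps omega_sq_mult omega_sq)
  then show ?thesis using R_I by metis
qed

lemma R_minus_iff [simp]: "- x \<in> R \<longleftrightarrow> x \<in> R"
proof -
  have "- x \<in> R" if "x \<in> R" for x using R_mult[OF R_of_int[of "- 1"] that] by simp
  from this[of x] this[of "- x"] show ?thesis by auto
qed

lemma R_diff [simp, intro]: "x \<in> R \<Longrightarrow> y \<in> R \<Longrightarrow> x - y \<in> R"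
  using R_add[of x "- y"] by simp

lemma R_cnj [simp, intro]: "x \<in> R \<Longrightarrow> cnj x \<in> R"
  by (erule R_cases) (simp add: cnj_omega)

text \<open>The squared modulus is the field norm x * cnj x, hence an integer on \<open>R\<close>.
  It bounds units and measures progress in the Euclidean algorithm.\<close>

lemma norm_R:
  assumes "x = of_int a + of_int b * \<omega>"
  shows "(cmod x)\<^sup>2 = of_int (a * a - a * b + b * b)"
proof -
  have "complex_of_real ((cmod x)\<^sup>2) = x * cnj x" by (simp only: complex_norm_square)
  also have "\<dots> = complex_of_real (of_int (a * a - a * b + b * b))"
    by (simp add: assms cnj_omega algebra_simps omega_sq_mult omega_sq)
  finally show ?thesis by (simp only: of_real_eq_iff)
qed

text \<open>These are the sixth roots of unity, as \<open>- 1 - \<omega>\<close> is the square of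
  \<omega>.\<close>

definition units :: "complex set" where
  "units = {1, - 1, \<omega>, - \<omega>, 1 + \<omega>, - 1 - \<omega>}"

lemma units_R: "u \<in> units \<Longrightarrow> u \<in> R"
  by (auto simp: units_def)

lemma unitsI:
  assumes "x \<in> R" "y \<in> R" "x * y = 1"
  shows "x \<in> units"
proof -
  obtain a b where x: "x = of_int a + of_int b * \<omega>" by (rule R_cases[OF assms(1)])
  obtain c d where y: "y = of_int c + of_int d * \<omega>" by (rule R_cases[OF assms(2)])
  define N where "N a b = a * a - a * b + b * b" for a b :: int
  have "real_of_int (N a b) * real_of_int (N c d) = (cmod (x * y))\<^sup>2"
    using norm_R[OF x] norm_R[OF y] by (simp only: norm_mult power_mult_distrib N_def)
  also have "\<dots> = 1" by (simp add: assms(3))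
  finally have "N a b * N c d = 1" by (simp only: of_int_mult[symmetric] of_int_eq_1_iff)
  moreover have "N a b \<ge> 0"
    using norm_R[OF x] unfolding N_def by (metis of_int_0_le_iff zero_le_power2)
  ultimately have N: "N a b = 1" by (simp add: zmult_eq_1_iff)
  \<comment> \<open>Completing the square in either variable bounds both coordinates by 1. Of the
    nine remaining pairs exactly six have norm 1.\<close>
  have "(2 * a - b)\<^sup>2 + 3 * b\<^sup>2 = 4 * N a b" "(2 * b - a)\<^sup>2 + 3 * a\<^sup>2 = 4 * N a b"
    by (simp_all add: N_def power2_eq_square algebra_simps)
  then have "3 * b\<^sup>2 \<le> 4" "3 * a\<^sup>2 \<le> 4"
    using N zero_le_power2[of "2 * a - b"] zero_le_power2[of "2 * b - a"] by linarith+
  then have "b\<^sup>2 \<le> 1" "a\<^sup>2 \<le> 1" by simp_all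
  then have "\<bar>b\<bar> \<le> 1" "\<bar>a\<bar> \<le> 1" by (simp_all add: abs_square_le_1)
  then have "a \<in> {- 1, 0, 1}" "b \<in> {- 1, 0, 1}" by auto
  then show ?thesis using N by (auto simp: x N_def units_def)
qed

lemma omega_inverse:
  "1 / \<omega> = - 1 - \<omega>" "1 / (- \<omega>) = 1 + \<omega>"
  "1 / (1 + \<omega>) = - \<omega>" "1 / (- 1 - \<omega>) = \<omega>"
proof -
  have inv: "1 / x = y" if "x * y = 1" for x y :: complex
    using that by (metis mult_zero_left nonzero_mult_div_cancel_left zero_neq_one)
  show "1 / \<omega> = - 1 - \<omega>" "1 / (- \<omega>) = 1 + \<omega>"
    "1 / (1 + \<omega>) = - \<omega>" "1 / (- 1 - \<omega>) = \<omega>"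
    by (rule inv; simp add: algebra_simps omega_sq)+
qed

lemma units_inverse:
  assumes "u \<in> units"
  shows "1 / u \<in> units" "u \<noteq> 0"
proof -
  have "1 / (- 1) = (- 1 :: complex)" by simp
  then show "1 / u \<in> units"
    using assms unfolding units_def
    by (elim insertE emptyE) (simp_all only: omega_inverse div_by_1 insert_iff simp_thms)
  have "0 \<notin> units" using Im_omega_nonzero by (auto simp: units_def complex_eq_iff)
  with assms show "u \<noteq> 0" by auto
qed

lemma units_mult:
  assumes "u \<in> units" "v \<in> units"
  shows "u * v \<in> units"
proof (rule unitsI)
  show "u * v \<in> R" "(1 / u) * (1 / v) \<in> R"
    using assms units_R units_inverse by blast+
  show "(u * v) * ((1 / u) * (1 / v)) = 1"
    using units_inverse(2) assms by simp
qed

text \<open>The imaginary part fixes the coefficient of \<omega>; since \<open>Re \<omega>\<close>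
  is -1/2, the real part is corrected by half of it before rounding. The squared error is at most
  1/4 + (3/4)(1/4) = 7/16.\<close>

lemma approximate_by_R: "\<exists>q\<in>R. cmod (z - q) < 1"
proof -
  define b where "b = round (Im z / Im \<omega>)"
  define a where "a = round (Re z + of_int b / 2)"
  define q where "q = of_int a + of_int b * \<omega>"
  define e where "e = Re z + of_int b / 2 - of_int a"
  define d where "d = Im z / Im \<omega> - of_int b"
  have e: "\<bar>e\<bar> \<le> 1 / 2" and d: "\<bar>d\<bar> \<le> 1 / 2"
    using of_int_round_abs_le[of "Re z + of_int b / 2"] of_int_round_abs_le[of "Im z / Im \<omega>"]
    by (simp_all add: e_def d_def a_def b_def abs_minus_commute)
  have "Re (z - q) = e" by (simp add: q_def e_def Re_omega)
  moreover have "Im (z - q) = d * Im \<omega>"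
    using Im_omega_nonzero by (simp add: q_def d_def field_simps)
  ultimately have "(cmod (z - q))\<^sup>2 = e\<^sup>2 + d\<^sup>2 * (Im \<omega> * Im \<omega>)"
    by (simp only: cmod_power2 power_mult_distrib power2_eq_square[of "Im \<omega>"])
  also have "\<dots> < 1"
  proof -
    have "e\<^sup>2 \<le> 1 / 4" "d\<^sup>2 \<le> 1 / 4"
      using abs_le_square_iff[of e "1 / 2"] abs_le_square_iff[of d "1 / 2"] e d
      by (simp_all add: power2_eq_square)
    then show ?thesis by (simp add: Im_omega_sq)
  qed
  finally have "cmod (z - q) < 1" by (simp add: power_less_one_iff abs_square_less_1)
  moreover have "q \<in> R" unfolding q_def by (rule R_I)
  ultimately show ?thesis by blast
qed


section \<open>Generators of SL(2) over the Eisenstein integers\<close>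

abbreviation G where "G \<equiv> carrier (SL2 R)"

abbreviation matD where "matD \<equiv> mat2 \<omega> 0 0 (- 1 - \<omega>)"

lemma gens_in_G: "matS \<in> G" "upper 1 \<in> G" "matD \<in> G"
  by (simp_all add: algebra_simps omega_sq)

lemma G_mult: "A \<in> G \<Longrightarrow> B \<in> G \<Longrightarrow> A ** B \<in> G"
  by (simp add: carrier_SL2 det_mul) (simp add: matrix_matrix_mult_def sum_2)

text \<open>Generation is phrased with products only. Inverses are available anyway, because
  \<open>matD\<close> has order three and (ST)^3 = -1.\<close>

lemma G_induct [consumes 1, case_names S T D mult]:
  assumes "A \<in> G"
    and S: "P matS" and T: "P (upper 1)" and D: "P matD"
    and mult: "\<And>A B. A \<in> G \<Longrightarrow> B \<in> G \<Longrightarrow> P A \<Longrightarrow> P B \<Longrightarrow> P (A ** B)"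
  shows "P A"
proof -
  define Q where "Q A \<longleftrightarrow> A \<in> G \<and> P A" for A
  have Qmult: "Q (A ** B)" if "Q A" "Q B" for A B
    using that mult G_mult by (auto simp: Q_def)
  have QS: "Q matS" and QT: "Q (upper 1)" and QD: "Q matD"
    using S T D gens_in_G by (simp_all only: Q_def)
  have Qm1: "Q (mat2 (- 1) 0 0 (- 1))" using Qmult[OF QS QS] by simp
  have Q1: "Q (mat2 1 0 0 1)" using Qmult[OF Qm1 Qm1] by simp
  have Qneg: "Q (- A)" if "Q A" for A
    using Qmult[OF Qm1 that] by (cases A rule: mat2_cases) simp
  have QD2: "Q (mat2 (- 1 - \<omega>) 0 0 \<omega>)"
    using Qmult[OF QD QD] by (simp add: algebra_simps omega_sq)
  \<comment> \<open>By (ST)^3 = -1 this word is minus the inverse of \<open>upper 1\<close>.\<close>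
  have "Q (matS ** upper 1 ** matS ** upper 1 ** matS)"
    by (intro Qmult QS QT)
  then have QT': "Q (upper (- 1))" using Qneg by fastforce
  have QTn: "Q (upper (of_int n))" for n
  proof (induction n rule: int_induct[of _ 0])
    case base
    show ?case using Q1 by simp
  next
    case (step1 i)
    then show ?case using Qmult[OF _ QT] by (fastforce simp: add.commute)
  next
    case (step2 i)
    then show ?case using Qmult[OF _ QT'] by fastforce
  qed
  have QU: "Q (upper x)" if x_R: "x \<in> R" for x
  proof -
    obtain m n where x: "x = of_int m + of_int n * \<omega>" by (rule R_cases[OF x_R])
    \<comment> \<open>Conjugating by the inverse of \<open>matD\<close> multiplies the upper right
      entry by \<omega>^4 = \<omega>.\<close>
    have "upper x = upper (of_int m) ** (mat2 (- 1 - \<omega>) 0 0 \<omega> ** upper (of_int n) ** matD)"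
      by (simp add: x algebra_simps omega_sq omega_sq_mult)
    then show ?thesis by (metis Qmult QTn QD QD2)
  qed
  have Qdiag: "Q (mat2 u 0 0 (1 / u))" if "u \<in> units" for u
  proof -
    have "1 / (- 1) = (- 1 :: complex)" by simp
    moreover have "Q (mat2 (- \<omega>) 0 0 (1 + \<omega>))" "Q (mat2 (1 + \<omega>) 0 0 (- \<omega>))"
      using Qneg[OF QD] Qneg[OF QD2] by (simp_all add: add.commute)
    ultimately show ?thesis
      using that Q1 Qm1 QD QD2 unfolding units_def
      by (elim insertE emptyE) (simp_all only: omega_inverse div_by_1)
  qed
  have "A \<in> G \<Longrightarrow> Q A" for A
  \<comment> \<open>The squared modulus is an integer by \<open>norm_R\<close>; the floor and
    \<open>nat\<close> only change its type.\<close>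
  proof (induction "nat \<lfloor>(cmod (A $ 2 $ 1))\<^sup>2\<rfloor>" arbitrary: A rule: less_induct)
    case less
    obtain a b c d where A: "A = mat2 a b c d" by (rule mat2_cases)
    have R: "a \<in> R" "b \<in> R" "c \<in> R" "d \<in> R" and det: "a * d - b * c = 1"
      using less.prems by (simp_all add: A)
    show ?case
    proof (cases "c = 0")
      case True
      then have ad: "a * d = 1" using det by simp
      then have a0: "a \<noteq> 0" by auto
      have "a \<in> units" using ad R unitsI by blast
      moreover have "d = 1 / a" using ad by (metis mult_zero_left nonzero_mult_div_cancel_left zero_neq_one)
      then have "A = mat2 a 0 0 (1 / a) ** upper (d * b)"
        using True a0 by (simp add: A)
      ultimately show ?thesis using Qmult Qdiag QU R by (metis R_mult)
    next
      case False
      obtain q where q: "q \<in> R" "cmod (a / c - q) < 1" using approximate_by_R by blast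
      define r where "r = a - q * c"
      have "r \<in> R" unfolding r_def using R q(1) by blast
      have "cmod r = cmod c * cmod (a / c - q)"
        using False by (simp add: r_def norm_mult[symmetric] field_simps)
      then have lt: "cmod r < cmod c" using q(2) False by simp
      obtain k l where r: "r = of_int k + of_int l * \<omega>" using R_cases[OF \<open>r \<in> R\<close>] .
      obtain m n where c: "c = of_int m + of_int n * \<omega>" using R_cases[OF \<open>c \<in> R\<close>] .
      have "(cmod r)\<^sup>2 < (cmod c)\<^sup>2" using lt by (simp add: power_strict_mono)
      moreover have "(cmod r)\<^sup>2 \<ge> 0" by simp
      ultimately have lt': "nat \<lfloor>(cmod r)\<^sup>2\<rfloor> < nat \<lfloor>(cmod c)\<^sup>2\<rfloor>"
        unfolding norm_R[OF r] norm_R[OF c] floor_of_int by linarith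
      \<comment> \<open>This is \<open>matS ** upper (- q) ** A\<close>: the row operation leaves
        the remainder \<open>r\<close> in the first column, and \<open>matS\<close> moves it to the
        lower left.\<close>
      define B where "B = mat2 (- c) (- d) r (b - q * d)"
      have "B \<in> G"
        using R q(1) det \<open>r \<in> R\<close> by (auto simp: B_def r_def algebra_simps)
      then have "Q B" using less.hyps[of B] lt' by (simp add: A B_def)
      moreover have "A = - (upper q ** (matS ** B))"
        by (simp add: A B_def r_def)
      ultimately show ?thesis using Qneg Qmult QU[OF q(1)] QS by metis
    qed
  qed
  then show ?thesis using assms(1) Q_def by blast
qed

end

section \<open>Projective representations\<close>

text \<open>By Cayley-Hamilton m^2 = t m - 1 with t the trace, so a scalar square forces t = 0 or a
  scalar m.\<close>

lemma matrix_square_pm1: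
  fixes m :: "complex^2^2"
  assumes "det m = 1" "m ** m = mat 1 \<or> m ** m = - mat 1"
  shows "m = mat 1 \<or> m = - mat 1 \<or> trace m = 0"
proof -
  obtain a b c d where m: "m = mat2 a b c d" by (rule mat2_cases)
  have det: "a * d - b * c = 1" using assms(1) by (simp add: m)
  obtain e where "m ** m = mat2 e 0 0 e"
    using assms(2) by (auto simp: mat_eq_mat2)
  then have e: "a * a + b * c = e" "a * b + b * d = 0" "c * a + d * c = 0" "c * b + d * d = e"
    by (simp_all add: m)
  have "b * (a + d) = a * b + b * d" "c * (a + d) = c * a + d * c"
    "(a - d) * (a + d) = (a * a + b * c) - (c * b + d * d)"
    by (simp_all add: algebra_simps)
  then have eqs: "b * (a + d) = 0" "c * (a + d) = 0" "(a - d) * (a + d) = 0"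
    unfolding e by simp_all
  show ?thesis
  proof (cases "a + d = 0")
    case False
    then have "b = 0" "c = 0" "a = d" using eqs by simp_all
    then show ?thesis using det by (auto simp: m mat_eq_mat2 square_eq_1_iff)
  qed (simp add: m)
qed

text \<open>By Cayley-Hamilton m^3 = (t^2 - 1) m - t with t the trace, so a scalar cube forces t^2 =
  1 or a scalar m. The coefficient t^2 - 1 is \<open>\<tau>\<close> below.\<close>

lemma matrix_cube_pm1:
  fixes m :: "complex^2^2"
  assumes "det m = 1" "m ** m ** m = mat 1 \<or> m ** m ** m = - mat 1"
  shows "m = mat 1 \<or> m = - mat 1 \<or> trace m = 1 \<or> trace m = - 1"
proof -
  obtain a b c d where m: "m = mat2 a b c d" by (rule mat2_cases)
  have det: "a * d = 1 + b * c" using assms(1) by (simp add: m algebra_simps)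
  define \<tau> where "\<tau> = (a + d) * (a + d) - 1"
  have cube: "m ** m ** m = mat2 (\<tau> * a - (a + d)) (\<tau> * b) (\<tau> * c) (\<tau> * d - (a + d))"
  proof -
    have bc: "b * c = a * d - 1" using det by simp
    have "m ** m ** m = mat2 (a * a * a + 2 * a * (b * c) + d * (b * c))
        (b * (a * a + b * c + a * d + d * d)) (c * (a * a + b * c + a * d + d * d))
        (d * d * d + 2 * d * (b * c) + a * (b * c))"
      by (simp add: m algebra_simps)
    then show ?thesis unfolding bc by (simp add: \<tau>_def algebra_simps)
  qed
  show ?thesis
  proof (cases "\<tau> = 0")
    case True
    then show ?thesis by (simp add: \<tau>_def m square_eq_1_iff)
  next
    case False
    obtain e where "m ** m ** m = mat2 e 0 0 e"
      using assms(2) by (auto simp: mat_eq_mat2)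
    then have "\<tau> * b = 0" "\<tau> * c = 0" "\<tau> * a - (a + d) = e" "\<tau> * d - (a + d) = e"
      unfolding cube by simp_all
    then have "\<tau> * b = 0" "\<tau> * c = 0" "\<tau> * a = \<tau> * d"
      by (simp_all add: diff_eq_eq)
    then have "b = 0" "c = 0" "a = d" using False by simp_all
    then show ?thesis using det by (auto simp: m mat_eq_mat2 square_eq_1_iff)
  qed
qed

text \<open>A representation of PSL(2,Z[\<omega>]) pulled back to matrices, where relations become
  explicit products. Invariance under the sign records that it factors through the quotient.\<close>

locale eisenstein_rep = eisenstein +
  fixes f :: "complex^2^2 \<Rightarrow> (complex^2^2) set"
  assumes f_carrier: "A \<in> G \<Longrightarrow> f A \<in> carrier PSL2C"
    and f_mult: "A \<in> G \<Longrightarrow> B \<in> G \<Longrightarrow> f (A ** B) = f A \<otimes>\<^bsub>PSL2C\<^esub> f B"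
    and f_minus: "f (- A) = f A"
begin

lemma G_one: "mat 1 \<in> G"
  by (simp add: mat_eq_mat2)

lemma f_one: "f (mat 1) = to_PSL2C (mat 1)"
proof -
  have "f (mat 1) \<otimes>\<^bsub>PSL2C\<^esub> f (mat 1) = f (mat 1)"
    using f_mult[OF G_one G_one] by simp
  then have "f (mat 1) = \<one>\<^bsub>PSL2C\<^esub>"
    using f_carrier[OF G_one] group.l_cancel_one[OF group_PSL2C] by blast
  then show ?thesis by (simp add: to_PSL2C_one)
qed

lemma f_lift:
  assumes "A \<in> G"
  obtains a where "det a = 1" "f A = to_PSL2C a"
  using f_carrier[OF assms] by (rule PSL2C_cases)

lemma f_mult_lift:
  assumes "A \<in> G" "B \<in> G" "f A = to_PSL2C a" "f B = to_PSL2C b"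
  shows "f (A ** B) = to_PSL2C (a ** b)"
  using assms by (simp add: f_mult to_PSL2C_mult)

lemma f_cong:
  assumes "A \<in> G" "A' \<in> G" "B \<in> G" "B' \<in> G" "f A = f A'" "f B = f B'"
  shows "f (A ** B) = f (A' ** B')"
  using assms by (simp add: f_mult)

section \<open>Bruhat normal forms modulo the kernel\<close>

definition unip :: "complex \<Rightarrow> complex \<Rightarrow> complex^2^2" where
  "unip u x = mat2 u (u * x) 0 (1 / u)"

text \<open>The product of \<open>unip u x\<close>, \<open>matS\<close> and \<open>upper y\<close>:
  an element of the big cell whose lower left entry is a unit.\<close>

definition bruhat :: "complex \<Rightarrow> complex \<Rightarrow> complex \<Rightarrow> complex^2^2" where
  "bruhat u x y = mat2 (u * x) (u * x * y - u) (1 / u) (y / u)"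

lemma unip_G: "u \<in> units \<Longrightarrow> x \<in> R \<Longrightarrow> unip u x \<in> G"
  using units_inverse[of u] units_R[of u] units_R[of "1 / u"]
  by (simp add: unip_def)

lemma upper_G: "x \<in> R \<Longrightarrow> upper x \<in> G"
  by simp

lemma unip_eq: "unip u x = mat2 u 0 0 (1 / u) ** upper x"
  by (simp add: unip_def)

lemma bruhat_eq: "u \<noteq> 0 \<Longrightarrow> bruhat u x y = unip u x ** (matS ** upper y)"
  by (simp add: bruhat_def unip_def field_simps)

lemma diag_G: "u \<in> units \<Longrightarrow> mat2 u 0 0 (1 / u) \<in> G"
  using unip_G[of u 0] by (simp add: unip_def)

lemma bruhat_G: "u \<in> units \<Longrightarrow> x \<in> R \<Longrightarrow> y \<in> R \<Longrightarrow> bruhat u x y \<in> G"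
  by (metis bruhat_eq units_inverse(2) G_mult unip_G gens_in_G(1) upper_G)

lemma normal_form:
  assumes fin: "\<And>x. x \<in> R \<Longrightarrow> \<exists>v\<in>insert 0 units. f (upper x) = f (upper v)"
    and "A \<in> G"
  shows "\<exists>u\<in>units. \<exists>x\<in>R. \<exists>y\<in>R. f A = f (unip u x) \<or> f A = f (bruhat u x y)"
proof -
  define P where
    "P A \<longleftrightarrow> (\<exists>u\<in>units. \<exists>x\<in>R. \<exists>y\<in>R. f A = f (unip u x) \<or> f A = f (bruhat u x y))" for A
  have P_unip: "P A" if "f A = f (unip u x)" "u \<in> units" "x \<in> R" for A u x
    using that unfolding P_def by blast
  have P_bruhat: "P A" if "f A = f (bruhat u x y)" "u \<in> units" "x \<in> R" "y \<in> R" for A u x y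
    using that unfolding P_def by blast
  \<comment> \<open>\<open>P\<close> depends on a matrix only through its image, so stability under
    right multiplication need only be checked on the two normal forms.\<close>
  have step: "\<forall>A\<in>G. P A \<longrightarrow> P (A ** B)"
    if B: "B \<in> G"
      and 1: "\<And>u x. u \<in> units \<Longrightarrow> x \<in> R \<Longrightarrow> P (unip u x ** B)"
      and 2: "\<And>u x y. u \<in> units \<Longrightarrow> x \<in> R \<Longrightarrow> y \<in> R \<Longrightarrow> P (bruhat u x y ** B)" for B
  proof (intro ballI impI)
    fix A assume A: "A \<in> G" and "P A"
    then consider u x where "u \<in> units" "x \<in> R" "f A = f (unip u x)"
      | u x y where "u \<in> units" "x \<in> R" "y \<in> R" "f A = f (bruhat u x y)"
      unfolding P_def by blast
    then show "P (A ** B)"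
    proof cases
      case 1
      then have "f (A ** B) = f (unip u x ** B)"
        using f_cong[OF A unip_G B B] by blast
      then show ?thesis using that(2)[of u x] 1 unfolding P_def by simp
    next
      case 2
      then have "f (A ** B) = f (bruhat u x y ** B)"
        using f_cong[OF A bruhat_G B B] by blast
      then show ?thesis using that(3)[of u x y] 2 unfolding P_def by simp
    qed
  qed
  have omega_units: "\<omega> \<in> units" "- 1 - \<omega> \<in> units" by (simp_all add: units_def)
  have "\<forall>A\<in>G. P A \<longrightarrow> P (A ** B)" if "B \<in> G" for B
    using that
  proof (induction B rule: G_induct)
    case S
    show ?case
    proof (rule step[OF gens_in_G(1)])
      fix u x assume ux: "u \<in> units" "x \<in> R"
      have "unip u x ** matS = bruhat u x 0" by (simp add: unip_def bruhat_def)
      then show "P (unip u x ** matS)" by (intro P_bruhat[of _ u x 0]) (use ux in simp_all)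
    next
      fix u x y assume uxy: "u \<in> units" "x \<in> R" "y \<in> R"
      note u0 = units_inverse(2)[OF uxy(1)]
      \<comment> \<open>The lower left entry of \<open>bruhat u x y ** matS\<close> is y/u, which
        fits neither normal form unless \<open>y\<close> is 0 or a unit; hence \<open>y\<close> is
        replaced before multiplying.\<close>
      obtain v where v: "v \<in> insert 0 units" "f (upper y) = f (upper v)"
        using fin[OF uxy(3)] by blast
      have "v \<in> R" using v(1) units_R by auto
      have "f (unip u x ** (matS ** upper y)) = f (unip u x ** (matS ** upper v))"
        by (intro f_cong unip_G G_mult gens_in_G upper_G uxy \<open>v \<in> R\<close> v(2) refl)
      then have "f (bruhat u x y) = f (bruhat u x v)" by (simp only: bruhat_eq[OF u0])
      then have eq: "f (bruhat u x y ** matS) = f (bruhat u x v ** matS)"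
        by (intro f_cong bruhat_G gens_in_G uxy \<open>v \<in> R\<close> refl)
      show "P (bruhat u x y ** matS)"
      proof (cases "v = 0")
        case True
        then have "bruhat u x v ** matS = - unip u x"
          by (simp add: unip_def bruhat_def)
        with eq have "f (bruhat u x y ** matS) = f (unip u x)" by (simp only: f_minus)
        then show ?thesis using P_unip uxy by blast
      next
        case False
        then have vu: "v \<in> units" using v(1) by simp
        \<comment> \<open>For u = 1 and x = 0 the left side is lower triangular with off-diagonal
          entry \<open>v\<close>; it lies in the big cell over \<open>R\<close> because
          \<open>v\<close> is invertible there.\<close>
        have "bruhat u x v ** matS = bruhat (u * (1 / v)) (x * (v * v) - v) (- (1 / v))"
          using u0 False by (simp add: bruhat_def field_simps)
        with eq have "f (bruhat u x y ** matS)
            = f (bruhat (u * (1 / v)) (x * (v * v) - v) (- (1 / v)))" by (simp only:)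
        moreover have "u * (1 / v) \<in> units" "x * (v * v) - v \<in> R" "- (1 / v) \<in> R"
          using uxy vu \<open>v \<in> R\<close> units_inverse units_mult units_R R_minus_iff by blast+
        ultimately show ?thesis using P_bruhat by blast
      qed
    qed
  next
    case T
    show ?case
    proof (rule step[OF gens_in_G(2)])
      fix u x assume ux: "u \<in> units" "x \<in> R"
      have "unip u x ** upper 1 = unip u (x + 1)" by (simp add: unip_def algebra_simps)
      then show "P (unip u x ** upper 1)"
        by (intro P_unip[of _ u "x + 1"]) (use ux in simp_all)
    next
      fix u x y assume uxy: "u \<in> units" "x \<in> R" "y \<in> R"
      have "bruhat u x y ** upper 1 = bruhat u x (y + 1)"
        by (simp add: bruhat_def algebra_simps add_divide_distrib)
      then show "P (bruhat u x y ** upper 1)"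
        by (intro P_bruhat[of _ u x "y + 1"]) (use uxy in simp_all)
    qed
  next
    case D
    show ?case
    proof (rule step[OF gens_in_G(3)])
      fix u x assume ux: "u \<in> units" "x \<in> R"
      have "1 / (u * \<omega>) = (- 1 - \<omega>) / u"
        using omega_inverse(1) by (metis divide_divide_eq_left mult.commute)
      then have "unip u x ** matD = unip (u * \<omega>) (x * \<omega>)"
        by (simp add: unip_def algebra_simps omega_sq omega_sq_mult diff_divide_distrib)
      then show "P (unip u x ** matD)"
        by (intro P_unip[of _ "u * \<omega>" "x * \<omega>"])
          (use ux omega_units units_mult in simp_all)
    next
      fix u x y assume uxy: "u \<in> units" "x \<in> R" "y \<in> R"
      have "1 / (u * (- 1 - \<omega>)) = \<omega> / u"
        using omega_inverse(4) by (metis divide_divide_eq_left mult.commute)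
      moreover have "y * \<omega> / (u * (- 1 - \<omega>)) = y * \<omega> * (1 / (u * (- 1 - \<omega>)))" by simp
      \<comment> \<open>Moving \<open>matD\<close> to the left across \<open>matS\<close> inverts
        it, hence the factor \<open>- 1 - \<omega>\<close> in the first two parameters.\<close>
      ultimately have "bruhat u x y ** matD
          = bruhat (u * (- 1 - \<omega>)) (x * (- 1 - \<omega>)) (y * \<omega>)"
        unfolding bruhat_def mat2_mult mat2_eq_iff
        by (simp add: algebra_simps omega_sq omega_sq_mult add_divide_distrib diff_divide_distrib)
      then show "P (bruhat u x y ** matD)"
        by (intro P_bruhat[of _ "u * (- 1 - \<omega>)" "x * (- 1 - \<omega>)" "y * \<omega>"])
          (use uxy omega_units units_mult in simp_all)
    qed
  next
    case (mult A B)
    show ?case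
    proof (intro ballI impI)
      fix C assume C: "C \<in> G" "P C"
      have "P (C ** A)" using mult.IH(1) C by blast
      then have "P (C ** A ** B)" using mult.IH(2) G_mult[OF C(1) mult.hyps(1)] by blast
      then show "P (C ** (A ** B))" by (simp add: matrix_mul_assoc)
    qed
  qed
  moreover have "P (mat 1)"
    by (rule P_unip[of _ 1 0]) (simp_all add: unip_def mat_eq_mat2 units_def)
  ultimately have "P (mat 1 ** A)" using assms(2) G_one by blast
  then show ?thesis by (simp add: P_def)
qed

text \<open>The parameters x and y of the normal forms can themselves be taken from 0 and the six
  units, which leaves at most 6*7 + 6*7*7 images.\<close>

lemma finite_image:
  assumes fin: "\<And>x. x \<in> R \<Longrightarrow> \<exists>v\<in>insert 0 units. f (upper x) = f (upper v)"
  shows "finite (f ` G)"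
proof -
  define V where "V = insert 0 units"
  have V_R: "v \<in> R" if "v \<in> V" for v using that units_R by (auto simp: V_def)
  have unip: "\<exists>v\<in>V. f (unip u x) = f (unip u v)" if ux: "u \<in> units" "x \<in> R" for u x
  proof -
    obtain v where v: "v \<in> V" "f (upper x) = f (upper v)" using fin[OF ux(2)] V_def by blast
    then have "f (unip u x) = f (unip u v)"
      unfolding unip_eq by (intro f_cong diag_G upper_G V_R ux refl)
    then show ?thesis using v(1) by blast
  qed
  have bruhat: "\<exists>v\<in>V. \<exists>w\<in>V. f (bruhat u x y) = f (bruhat u v w)"
    if uxy: "u \<in> units" "x \<in> R" "y \<in> R" for u x y
  proof -
    obtain v where v: "v \<in> V" "f (unip u x) = f (unip u v)" using unip uxy by blast
    obtain w where w: "w \<in> V" "f (upper y) = f (upper w)" using fin[OF uxy(3)] V_def by blast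
    have "f (unip u x ** (matS ** upper y)) = f (unip u v ** (matS ** upper w))"
      by (intro f_cong G_mult unip_G gens_in_G upper_G V_R uxy v w refl)
    then have "f (bruhat u x y) = f (bruhat u v w)"
      using bruhat_eq units_inverse(2)[OF uxy(1)] by simp
    then show ?thesis using v(1) w(1) by blast
  qed
  have "finite V" by (simp add: V_def units_def)
  moreover have "finite units" by (simp add: units_def)
  ultimately have "finite ((\<Union>u\<in>units. \<Union>v\<in>V. {f (unip u v)}) \<union>
      (\<Union>u\<in>units. \<Union>v\<in>V. \<Union>w\<in>V. {f (bruhat u v w)}))" (is "finite ?F")
    by (intro finite_UnI finite_UN_I) simp_all
  moreover have "f ` G \<subseteq> ?F"
  proof
    fix Y assume "Y \<in> f ` G"
    then obtain A where A: "A \<in> G" and Y: "Y = f A" by blast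
    have "\<exists>u\<in>units. \<exists>x\<in>R. \<exists>y\<in>R. f A = f (unip u x) \<or> f A = f (bruhat u x y)"
      using fin A by (rule normal_form)
    then obtain u x y where u: "u \<in> units" and xy: "x \<in> R" "y \<in> R"
      and or: "f A = f (unip u x) \<or> f A = f (bruhat u x y)" by blast
    obtain v where v: "v \<in> V" "f (unip u x) = f (unip u v)"
      using unip[OF u xy(1)] by (elim bexE) (rule that)
    obtain v' w where w: "v' \<in> V" "w \<in> V" "f (bruhat u x y) = f (bruhat u v' w)"
      using bruhat[OF u xy] by (elim bexE) (rule that)
    have "Y = f (unip u v) \<or> Y = f (bruhat u v' w)"
      using or v(2) w(3) Y by argo
    then show "Y \<in> ?F" using u v(1) w(1,2) by blast
  qed
  ultimately show ?thesis by (rule finite_subset[rotated])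
qed

section \<open>The quotients A_5 and A_4\<close>

lemma upper_period:
  assumes "f (upper y) = f (mat 1)" "y \<in> R" "x \<in> R"
  shows "f (upper (x + of_int j * y)) = f (upper x)"
proof -
  have shift: "f (upper (z + y)) = f (upper z)" if "z \<in> R" for z
  proof -
    have "f (upper z ** upper y) = f (upper z ** mat 1)"
      by (intro f_cong upper_G that assms G_one refl)
    then show ?thesis by (simp add: add.commute)
  qed
  show ?thesis
  proof (induction j rule: int_induct[of _ 0])
    case base
    show ?case by simp
  next
    case (step1 i)
    then show ?case using shift[of "x + of_int i * y"] assms(2,3) by (simp add: algebra_simps)
  next
    case (step2 i)
    then show ?case
      using shift[of "x + of_int (i - 1) * y"] assms(2,3) by (simp add: algebra_simps)
  qed
qed

lemma upper_omega:
  assumes "x \<in> R"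
  shows "upper (x * \<omega>) = matD ** matD ** upper x ** matD"
  by (simp add: algebra_simps omega_sq omega_sq_mult)

text \<open>Conjugation by powers of D carries the relation from 2 to 2 \<omega>, so the image of
  \<open>upper x\<close> depends only on \<open>x\<close> modulo 2. The residues 0, 1, \<omega>, 1 +
  \<omega> are 0 or units.\<close>

lemma finite_image_if_involution:
  assumes "f (upper 2) = f (mat 1)"
  shows "finite (f ` G)"
proof (rule finite_image)
  fix x assume "x \<in> R"
  then obtain m n where x: "x = of_int m + of_int n * \<omega>" by (rule R_cases)
  have two: "2 \<in> R" using R_of_int[of 2] by simp
  have "f (upper (2 * \<omega>)) = f (matD ** matD ** mat 1 ** matD)"
    unfolding upper_omega[OF two] by (intro f_cong G_mult gens_in_G upper_G two G_one assms refl)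
  moreover have "matD ** matD ** mat 1 ** matD = mat 1"
    by (simp add: mat_eq_mat2 algebra_simps omega_sq omega_sq_mult)
  ultimately have two_omega: "f (upper (2 * \<omega>)) = f (mat 1)" by simp
  obtain m\<^sub>0 m\<^sub>1 where m: "m = m\<^sub>0 + m\<^sub>1 * 2" "m\<^sub>0 = 0 \<or> m\<^sub>0 = 1"
    using mod_div_mult_eq[of m 2] not_mod_2_eq_0_eq_1[of m] by metis
  obtain n\<^sub>0 n\<^sub>1 where n: "n = n\<^sub>0 + n\<^sub>1 * 2" "n\<^sub>0 = 0 \<or> n\<^sub>0 = 1"
    using mod_div_mult_eq[of n 2] not_mod_2_eq_0_eq_1[of n] by metis
  have "x = (of_int m\<^sub>0 + of_int n\<^sub>0 * \<omega> + of_int m\<^sub>1 * 2) + of_int n\<^sub>1 * (2 * \<omega>)"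
    by (simp add: x m(1) n(1) algebra_simps)
  then have "f (upper x) = f (upper (of_int m\<^sub>0 + of_int n\<^sub>0 * \<omega> + of_int m\<^sub>1 * 2))"
    using upper_period[OF two_omega] two by simp
  also have "\<dots> = f (upper (of_int m\<^sub>0 + of_int n\<^sub>0 * \<omega>))"
    by (rule upper_period[OF assms two R_I])
  finally have *: "f (upper x) = f (upper (of_int m\<^sub>0 + of_int n\<^sub>0 * \<omega>))" .
  have "of_int m\<^sub>0 + of_int n\<^sub>0 * \<omega> \<in> insert 0 units"
    using m(2) n(2) by (auto simp: units_def)
  then show "\<exists>v\<in>insert 0 units. f (upper x) = f (upper v)" using * by blast
qed

text \<open>If D acts trivially, conjugation by it identifies the images of \<open>upper x\<close>
  and \<open>upper (x * \<omega>)\<close>. Together with period 3 this amounts to reducing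
  \<open>x\<close> modulo 1 - \<omega>.\<close>

lemma finite_image_if_D_trivial:
  assumes D: "f matD = f (mat 1)"
  shows "finite (f ` G)"
proof (rule finite_image)
  have TD: "f (upper 1 ** matD) = f (upper 1)"
    using f_cong[OF gens_in_G(2) gens_in_G(2) gens_in_G(3) G_one refl D] by simp
  \<comment> \<open>The matrix \<open>upper 1 ** matD\<close> has the distinct eigenvalues \<omega>
    and \<omega>^2, so its cube is 1, while its image is that of \<open>upper 1\<close>.\<close>
  have "f (upper 1 ** matD ** (upper 1 ** matD) ** (upper 1 ** matD))
      = f (upper 1 ** upper 1 ** upper 1)"
    by (intro f_cong G_mult gens_in_G TD)
  moreover have "upper 1 ** matD ** (upper 1 ** matD) ** (upper 1 ** matD) = mat 1"
    by (simp add: mat_eq_mat2 algebra_simps omega_sq omega_sq_mult)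
  moreover have "upper 1 ** upper 1 ** upper 1 = upper 3" by simp
  ultimately have three: "f (upper 3) = f (mat 1)" by simp
  fix x assume "x \<in> R"
  then obtain m n where x: "x = of_int m + of_int n * \<omega>" by (rule R_cases)
  define k where "k = m + n"
  have "f (matD ** matD ** upper (of_int n) ** matD) = f (mat 1 ** mat 1 ** upper (of_int n) ** mat 1)"
    by (intro f_cong G_mult gens_in_G upper_G G_one D R_of_int refl)
  then have "f (upper (of_int n * \<omega>)) = f (upper (of_int n))"
    by (simp only: upper_omega[OF R_of_int] matrix_mul_lid matrix_mul_rid)
  then have "f (upper (of_int m) ** upper (of_int n * \<omega>)) = f (upper (of_int m) ** upper (of_int n))"
    by (intro f_cong upper_G R_of_int R_mult R_omega refl)
  then have "f (upper x) = f (upper (of_int k))"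
    by (simp add: x k_def add.commute)
  \<comment> \<open>The shift by 1 selects the representatives -1, 0, 1 modulo 3; the usual
    remainder 2 is not a unit.\<close>
  also have "of_int k = of_int ((k + 1) mod 3 - 1) + of_int ((k + 1) div 3) * (3 :: complex)"
  proof -
    have "k = ((k + 1) mod 3 - 1) + ((k + 1) div 3) * 3"
      using mod_div_mult_eq[of "k + 1" 3] by linarith
    then show ?thesis by (metis of_int_add of_int_mult of_int_numeral)
  qed
  also have "f (upper \<dots>) = f (upper (of_int ((k + 1) mod 3 - 1)))"
    by (rule upper_period[OF three _ R_of_int]) (metis R_of_int of_int_numeral)
  finally have *: "f (upper x) = f (upper (of_int ((k + 1) mod 3 - 1)))" .
  have "(k + 1) mod 3 = 0 \<or> (k + 1) mod 3 = 1 \<or> (k + 1) mod 3 = 2" by auto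
  then have "of_int ((k + 1) mod 3 - 1) \<in> insert 0 units" by (auto simp: units_def)
  then show "\<exists>v\<in>insert 0 units. f (upper x) = f (upper v)" using * by blast
qed

end

section \<open>Classification of representations with infinite image\<close>

context eisenstein
begin

text \<open>An eigenvector v of d and its image w = s v become the columns of g. The relations make
  s^2 = -1 and put w in the other eigenspace, so s and, up to sign, d take their standard
  form.\<close>

lemma simultaneous_normal_form:
  fixes s d :: "complex^2^2"
  assumes det: "det s = 1" "det d = 1"
    and s2: "s ** s = mat 1 \<or> s ** s = - mat 1"
    and sd2: "(s ** d) ** (s ** d) = mat 1 \<or> (s ** d) ** (s ** d) = - mat 1"
    and d3: "d ** d ** d = mat 1 \<or> d ** d ** d = - mat 1"
    and d: "d \<noteq> mat 1" "d \<noteq> - mat 1"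
  obtains g where "det g = 1" "s ** g = g ** matS" "d ** g = g ** matD \<or> - d ** g = g ** matD"
proof -
  have d_square: "\<not> (d ** d = mat 1 \<or> d ** d = - mat 1)"
  proof
    assume "d ** d = mat 1 \<or> d ** d = - mat 1"
    then have "d ** d ** d = d \<or> d ** d ** d = - d" by (auto simp: minus_matrix_mult)
    then show False using d3 d by (metis minus_minus)
  qed
  \<comment> \<open>Of the two lifts, the one with trace -1 has the eigenvalues \<omega> and
    \<omega>^2.\<close>
  obtain d' where d': "d' = d \<or> d' = - d" and tr_d': "trace d' = - 1"
  proof -
    have "trace (- d) = - trace d" by (cases d rule: mat2_cases) simp
    moreover have "trace d = 1 \<or> trace d = - 1" using matrix_cube_pm1[OF det(2) d3] d by blast
    ultimately show ?thesis using that by fastforce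
  qed
  have det_d': "det d' = 1" using d' det(2) by (cases d rule: mat2_cases) auto
  have s: "s \<noteq> mat 1" "s \<noteq> - mat 1"
    using sd2 d_square by (auto simp: minus_matrix_mult)
  then have tr_s: "trace s = 0" using matrix_square_pm1[OF det(1) s2] by blast
  have tr_sd: "trace (s ** d') = 0"
  proof -
    have sd'2: "(s ** d') ** (s ** d') = mat 1 \<or> (s ** d') ** (s ** d') = - mat 1"
      using d' sd2 by (auto simp: minus_matrix_mult)
    have "s ** d' \<noteq> mat 1" "s ** d' \<noteq> - mat 1"
    proof -
      \<comment> \<open>If s d' were 1 or -1, then d' would be the inverse of s up to sign and have
        trace 0 instead of -1.\<close>
      have "d' = adj2 s ** (s ** d')"
        using adj2_mult[OF det(1)] by (simp add: matrix_mul_assoc)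
      moreover have "trace (adj2 s ** mat 1) = 0" "trace (adj2 s ** (- mat 1)) = 0"
      proof -
        have "trace (adj2 s ** mat 1) = trace s" "trace (adj2 s ** (- mat 1)) = - trace s"
          by (cases s rule: mat2_cases, simp add: mat_eq_mat2)+
        then show "trace (adj2 s ** mat 1) = 0" "trace (adj2 s ** (- mat 1)) = 0"
          using tr_s by simp_all
      qed
      ultimately show "s ** d' \<noteq> mat 1" "s ** d' \<noteq> - mat 1" using tr_d' by auto
    qed
    then show ?thesis
      using matrix_square_pm1[OF _ sd'2] det(1) det_d' by (simp add: det_mul)
  qed
  obtain p q r p' where s_eq: "s = mat2 p q r p'" by (rule mat2_cases)
  have p': "p' = - p" using tr_s by (simp add: s_eq add_eq_0_iff)
  have "p * p = - det s - q * r" by (simp add: s_eq p')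
  then have det_s: "p * p = - 1 - q * r" by (simp only: det(1))
  obtain k l m k' where d'_eq: "d' = mat2 k l m k'" by (rule mat2_cases)
  have k': "k' = - 1 - k" using tr_d' by (simp add: d'_eq algebra_simps)
  have "l * m = - det d' - k - k * k" by (simp add: d'_eq k' algebra_simps)
  then have det_d: "l * m = - 1 - k - k * k" by (simp only: det_d')
  have tr: "2 * p * k + p + q * m + r * l = 0"
    using tr_sd by (simp add: s_eq d'_eq p' k' algebra_simps)
  \<comment> \<open>The vector (l, \<omega> - k) is annihilated by the first row of d' - \<omega>.
    If it vanishes, d' is lower triangular, and the substitute uses 1 + 2 \<omega>, the difference
    of the eigenvalues.\<close>
  obtain v1 v2 where v0: "v1 \<noteq> 0 \<or> v2 \<noteq> 0"
    and v1: "k * v1 + l * v2 = \<omega> * v1" and v2: "m * v1 + k' * v2 = \<omega> * v2"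
  proof (cases "l = 0 \<and> k = \<omega>")
    case True
    have "1 + 2 * \<omega> \<noteq> 0" using Im_omega_nonzero by (auto simp: complex_eq_iff)
    with True show ?thesis by (intro that[of "1 + 2 * \<omega>" m]) (simp_all add: k' algebra_simps)
  next
    case False
    have "m * l + k' * (\<omega> - k) = \<omega> * (\<omega> - k)"
      using det_d by (simp add: k' algebra_simps omega_sq)
    with False show ?thesis by (intro that[of l "\<omega> - k"]) (auto simp: algebra_simps)
  qed
  define w1 where "w1 = p * v1 + q * v2"
  define w2 where "w2 = r * v1 - p * v2"
  have sw: "p * w1 + q * w2 = - v1" "r * w1 - p * w2 = - v2"
  proof -
    have "p * w1 + q * w2 = (p * p + q * r) * v1" "r * w1 - p * w2 = (p * p + q * r) * v2"
      by (simp_all add: w1_def w2_def algebra_simps)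
    then show "p * w1 + q * w2 = - v1" "r * w1 - p * w2 = - v2" by (simp_all add: det_s)
  qed
  \<comment> \<open>Polarized Cayley-Hamilton: for tr s = 0 and tr d' = -1, the sum d' s + s d' + s
    is the scalar tr(s d'), which is 0. Applied to v it gives the eigenvalue -1 - \<omega> for
    w.\<close>
  have w1: "k * w1 + l * w2 = (- 1 - \<omega>) * w1"
  proof -
    have "k * w1 + l * w2 + w1 + (p * (k * v1 + l * v2) + q * (m * v1 + k' * v2))
        = (2 * p * k + p + q * m + r * l) * v1"
      by (simp add: w1_def w2_def k' algebra_simps)
    then have "k * w1 + l * w2 + w1 + \<omega> * w1 = 0"
      unfolding v1 v2 tr by (simp add: w1_def algebra_simps)
    then show ?thesis by (simp add: algebra_simps add_eq_0_iff)
  qed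
  have w2: "m * w1 + k' * w2 = (- 1 - \<omega>) * w2"
  proof -
    have "m * w1 + k' * w2 + w2 + (r * (k * v1 + l * v2) - p * (m * v1 + k' * v2))
        = (2 * p * k + p + q * m + r * l) * v2"
      by (simp add: w1_def w2_def k' algebra_simps)
    then have "m * w1 + k' * w2 + w2 + \<omega> * w2 = 0"
      unfolding v1 v2 tr by (simp add: w2_def algebra_simps)
    then show ?thesis by (simp add: algebra_simps add_eq_0_iff)
  qed
  define \<delta> where "\<delta> = v1 * w2 - v2 * w1"
  \<comment> \<open>Were w a multiple of v, it would lie in both eigenspaces and vanish, and then v
    = - s w would vanish too.\<close>
  have "\<delta> \<noteq> 0"
  proof
    assume "\<delta> = 0"
    then obtain \<kappa> where \<kappa>: "w1 = \<kappa> * v1" "w2 = \<kappa> * v2"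
    proof (cases "v1 = 0")
      case True
      then have "v2 \<noteq> 0" "w1 = 0" using \<open>\<delta> = 0\<close> v0 by (auto simp: \<delta>_def)
      then show ?thesis by (intro that[of "w2 / v2"]) (simp_all add: True)
    next
      case False
      then show ?thesis using \<open>\<delta> = 0\<close> by (intro that[of "w1 / v1"]) (simp_all add: \<delta>_def field_simps)
    qed
    have "(1 + 2 * \<omega>) * w1 = 0" "(1 + 2 * \<omega>) * w2 = 0"
    proof -
      have "k * w1 + l * w2 = \<kappa> * (k * v1 + l * v2)" "m * w1 + k' * w2 = \<kappa> * (m * v1 + k' * v2)"
        by (simp_all add: \<kappa> algebra_simps)
      then have "(- 1 - \<omega>) * w1 = \<omega> * w1" "(- 1 - \<omega>) * w2 = \<omega> * w2"
        unfolding v1 v2 w1 w2 by (simp_all add: \<kappa>)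
      moreover have "(1 + 2 * \<omega>) * w = \<omega> * w - (- 1 - \<omega>) * w" for w
        by (simp add: algebra_simps)
      ultimately show "(1 + 2 * \<omega>) * w1 = 0" "(1 + 2 * \<omega>) * w2 = 0"
        by (simp_all only: diff_self)
    qed
    moreover have "1 + 2 * \<omega> \<noteq> 0" using Im_omega_nonzero by (auto simp: complex_eq_iff)
    ultimately have "w1 = 0" "w2 = 0" by simp_all
    then show False using sw v0 by simp
  qed
  \<comment> \<open>Scaling both columns by the same factor preserves the matrix relations and makes
    the determinant 1.\<close>
  define c where "c = 1 / csqrt \<delta>"
  have "csqrt \<delta> * csqrt \<delta> = \<delta>" by (metis power2_csqrt power2_eq_square)
  then have c: "c * c * \<delta> = 1" using \<open>\<delta> \<noteq> 0\<close> by (auto simp: c_def field_simps)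
  define g where "g = mat2 (c * v1) (c * w1) (c * v2) (c * w2)"
  have "det g = c * c * \<delta>" by (simp add: g_def \<delta>_def algebra_simps)
  then have "det g = 1" by (simp add: c)
  moreover have "s ** g = g ** matS"
  proof -
    have "s ** g = mat2 (c * (p * v1 + q * v2)) (c * (p * w1 + q * w2))
        (c * (r * v1 - p * v2)) (c * (r * w1 - p * w2))"
      by (simp add: s_eq p' g_def algebra_simps)
    then show ?thesis unfolding sw by (simp add: g_def w1_def w2_def)
  qed
  moreover have "d' ** g = g ** matD"
  proof -
    have "d' ** g = mat2 (c * (k * v1 + l * v2)) (c * (k * w1 + l * w2))
        (c * (m * v1 + k' * v2)) (c * (m * w1 + k' * w2))"
      by (simp add: d'_eq g_def algebra_simps)
    then show ?thesis unfolding v1 v2 w1 w2 by (simp add: g_def algebra_simps)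
  qed
  ultimately show ?thesis using that d' by blast
qed

end

context eisenstein_rep
begin

lemma f_minus_one: "f (- mat 1) = to_PSL2C (mat 1)"
  by (simp only: f_minus f_one)

lemma square_lift:
  assumes "A \<in> G" "f A = to_PSL2C a" "A ** A = mat 1 \<or> A ** A = - mat 1"
  shows "a ** a = mat 1 \<or> a ** a = - mat 1"
proof -
  have "to_PSL2C (a ** a) = to_PSL2C (mat 1)"
    using f_mult_lift[OF assms(1,1,2,2)] assms(3) f_one f_minus_one by metis
  then show ?thesis by (simp only: to_PSL2C_eq_iff)
qed

lemma cube_lift:
  assumes "A \<in> G" "f A = to_PSL2C a" "A ** A ** A = mat 1 \<or> A ** A ** A = - mat 1"
  shows "a ** a ** a = mat 1 \<or> a ** a ** a = - mat 1"
proof -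
  have "f (A ** A ** A) = to_PSL2C (a ** a ** a)"
    using assms(1,2) by (intro f_mult_lift G_mult)
  then have "to_PSL2C (a ** a ** a) = to_PSL2C (mat 1)"
    using assms(3) f_one f_minus_one by metis
  then show ?thesis by (simp only: to_PSL2C_eq_iff)
qed

lemma conjugate_rep:
  assumes "det g = 1"
  shows "eisenstein_rep \<omega> (\<lambda>A. to_PSL2C g \<otimes>\<^bsub>PSL2C\<^esub> f A \<otimes>\<^bsub>PSL2C\<^esub> to_PSL2C (adj2 g))"
proof unfold_locales
  fix A assume A: "A \<in> G"
  then obtain a where a: "det a = 1" "f A = to_PSL2C a" by (rule f_lift)
  then show "to_PSL2C g \<otimes>\<^bsub>PSL2C\<^esub> f A \<otimes>\<^bsub>PSL2C\<^esub> to_PSL2C (adj2 g) \<in> carrier PSL2C"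
    using assms by (auto simp: to_PSL2C_mult PSL2_carrier det_mul)
  fix B assume B: "B \<in> G"
  then obtain b where b: "det b = 1" "f B = to_PSL2C b" by (rule f_lift)
  have "g ** (a ** b) ** adj2 g = (g ** a ** adj2 g) ** (g ** b ** adj2 g)"
    using adj2_mult[OF assms] by (metis matrix_mul_assoc matrix_mul_rid)
  then show "to_PSL2C g \<otimes>\<^bsub>PSL2C\<^esub> f (A ** B) \<otimes>\<^bsub>PSL2C\<^esub> to_PSL2C (adj2 g) =
      (to_PSL2C g \<otimes>\<^bsub>PSL2C\<^esub> f A \<otimes>\<^bsub>PSL2C\<^esub> to_PSL2C (adj2 g)) \<otimes>\<^bsub>PSL2C\<^esub>
      (to_PSL2C g \<otimes>\<^bsub>PSL2C\<^esub> f B \<otimes>\<^bsub>PSL2C\<^esub> to_PSL2C (adj2 g))"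
    using f_mult_lift[OF A B a(2) b(2)] a(2) b(2) by (simp add: to_PSL2C_mult)
next
  fix A
  show "to_PSL2C g \<otimes>\<^bsub>PSL2C\<^esub> f (- A) \<otimes>\<^bsub>PSL2C\<^esub> to_PSL2C (adj2 g) =
      to_PSL2C g \<otimes>\<^bsub>PSL2C\<^esub> f A \<otimes>\<^bsub>PSL2C\<^esub> to_PSL2C (adj2 g)"
    by (simp only: f_minus)
qed

text \<open>Two traces of the lift t = \<open>mat2 x y z w\<close> decide. The trace of
  \<open>matS ** t\<close> is y - z, and (ST)^3 = 1 makes it 1 or -1 unless \<open>matS ** t\<close>
  is scalar. The trace of t is x + w, and if it vanishes then t^2 = -1. Otherwise commutation with
  the conjugate by D yields y z = 0 and x = w.\<close>

lemma normalized_T: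
  assumes S: "f matS = to_PSL2C matS" and D: "f matD = to_PSL2C matD"
  shows "f (upper 2) = f (mat 1) \<or>
    f (upper 1) \<in> {to_PSL2C (upper 1), to_PSL2C (upper (- 1)),
      to_PSL2C (lower 1), to_PSL2C (lower (- 1))}"
proof -
  obtain t where t: "det t = 1" "f (upper 1) = to_PSL2C t" by (rule f_lift[OF gens_in_G(2)])
  obtain x y z w where t_eq: "t = mat2 x y z w" by (rule mat2_cases)
  have det: "x * w - y * z = 1" using t(1) by (simp add: t_eq)
  have ST: "f (matS ** upper 1) = to_PSL2C (matS ** t)"
    by (rule f_mult_lift[OF gens_in_G(1,2) S t(2)])
  have "matS ** upper 1 ** (matS ** upper 1) ** (matS ** upper 1) = - mat 1"
    by (simp add: mat_eq_mat2)
  with cube_lift[OF G_mult[OF gens_in_G(1,2)] ST]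
  have "(matS ** t) ** (matS ** t) ** (matS ** t) = mat 1 \<or>
      (matS ** t) ** (matS ** t) ** (matS ** t) = - mat 1" by blast
  from matrix_cube_pm1[OF _ this]
  have st: "matS ** t = mat 1 \<or> matS ** t = - mat 1 \<or> y - z = 1 \<or> y - z = - 1"
    using det by (simp add: t_eq algebra_simps)
  have involution: "f (upper 2) = f (mat 1)" if "x + w = 0"
  proof -
    have w: "w = - x" using that by (simp add: add_eq_0_iff)
    have "f (upper 1 ** upper 1) = to_PSL2C (t ** t)"
      by (rule f_mult_lift[OF gens_in_G(2,2) t(2,2)])
    moreover have "t ** t = - mat 1"
    proof -
      have "x * x + y * z = - (x * w - y * z)" "z * y + w * w = - (x * w - y * z)"
        by (simp_all add: w)
      then show ?thesis unfolding det by (simp add: t_eq mat_eq_mat2) (simp add: w)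
    qed
    ultimately show ?thesis by (simp add: f_one)
  qed
  show ?thesis
  proof (cases "matS ** t = mat 1 \<or> matS ** t = - mat 1")
    case True
    then have "x = 0" "w = 0" by (auto simp: t_eq mat_eq_mat2)
    then show ?thesis using involution by simp
  next
    case False
    with st have yz: "y - z = 1 \<or> y - z = - 1" by blast
    then have yz0: "y \<noteq> 0 \<or> z \<noteq> 0" by auto
    have *: "f (matD ** upper 1 ** matD ** matD) = to_PSL2C (matD ** t ** matD ** matD)"
      by (intro f_mult_lift G_mult gens_in_G S D t)
    (* e lifts the image of the conjugate of upper 1 by matD, which commutes with upper 1;
       so e and t commute up to sign. *)
    define e where "e = mat2 x ((- 1 - \<omega>) * y) (\<omega> * z) w"
    have e: "matD ** t ** matD ** matD = e"
      by (simp add: t_eq e_def algebra_simps omega_sq omega_sq_mult)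
    have "to_PSL2C (t ** e) = f (upper 1 ** (matD ** upper 1 ** matD ** matD))"
      by (rule f_mult_lift[symmetric]) (intro gens_in_G G_mult t *[unfolded e])+
    also have "upper 1 ** (matD ** upper 1 ** matD ** matD)
        = (matD ** upper 1 ** matD ** matD) ** upper 1"
      by (simp add: algebra_simps omega_sq omega_sq_mult)
    also have "f \<dots> = to_PSL2C (e ** t)"
      by (rule f_mult_lift) (intro gens_in_G G_mult t *[unfolded e])+
    finally consider "t ** e = e ** t" | "t ** e = - (e ** t)"
      unfolding to_PSL2C_eq_iff by blast
    then show ?thesis
    proof cases
      case 1
      have "(1 + 2 * \<omega>) * (y * z) = 0" "(2 + \<omega>) * (y * (w - x)) = 0" "(1 - \<omega>) * (z * (x - w)) = 0"
        using 1 by (simp_all add: t_eq e_def algebra_simps)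
      moreover have "1 + 2 * \<omega> \<noteq> 0" "2 + \<omega> \<noteq> 0" "1 - \<omega> \<noteq> 0"
        using Im_omega_nonzero by (auto simp: complex_eq_iff)
      ultimately have yz': "y * z = 0" and "y * (w - x) = 0" "z * (x - w) = 0" by simp_all
      with yz0 have "w = x" by auto
      then have "x * x = 1" using det yz' by simp
      then have "x = 1 \<or> x = - 1" by (simp add: square_eq_1_iff)
      moreover have "(z = 0 \<and> (y = 1 \<or> y = - 1)) \<or> (y = 0 \<and> (z = 1 \<or> z = - 1))"
        using yz yz' by (auto simp: minus_equation_iff[of z] eq_commute[of "- 1"])
      ultimately show ?thesis unfolding t(2) t_eq \<open>w = x\<close>
        by (elim disjE conjE; simp add: to_PSL2C_eq_iff)
    next
      case 2
      have "\<omega> * (y * (x + w)) = 0" "(1 + \<omega>) * (z * (x + w)) = 0"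
        using 2 by (simp_all add: t_eq e_def algebra_simps add_eq_0_iff)
      moreover have "1 + \<omega> \<noteq> 0" using Im_omega_nonzero by (auto simp: complex_eq_iff)
      ultimately have "x + w = 0" using yz0 omega_not_0 by auto
      then show ?thesis using involution by blast
    qed
  qed
qed

text \<open>Conjugation by diag(i, -i) fixes the classes of S and D and inverts T, which removes the
  sign. A lower triangular T is reached by complex conjugation followed by conjugation by S, each of
  which inverts D. Agreement on the three generators then spreads to \<open>G\<close>.\<close>

lemma normalized_classification:
  assumes S: "f matS = to_PSL2C matS" and D: "f matD = to_PSL2C matD"
    and inf: "infinite (f ` G)"
  obtains g \<tau> where "det g = 1" "\<tau> = id \<or> \<tau> = cnj_mat"
    "\<And>A. A \<in> G \<Longrightarrow> f A = to_PSL2C (g ** \<tau> A ** adj2 g)"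
proof -
  have "\<exists>g \<tau>. det g = 1 \<and> (\<tau> = id \<or> \<tau> = cnj_mat) \<and>
      matS \<in> {A. f A = to_PSL2C (g ** \<tau> A ** adj2 g)} \<and>
      matD \<in> {A. f A = to_PSL2C (g ** \<tau> A ** adj2 g)} \<and>
      upper 1 \<in> {A. f A = to_PSL2C (g ** \<tau> A ** adj2 g)}"
  proof -
    have "f (upper 2) \<noteq> f (mat 1)" using inf finite_image_if_involution by blast
    then consider "f (upper 1) = to_PSL2C (upper 1)" | "f (upper 1) = to_PSL2C (upper (- 1))"
      | "f (upper 1) = to_PSL2C (lower 1)" | "f (upper 1) = to_PSL2C (lower (- 1))"
      using normalized_T[OF S D] by blast
    then show ?thesis
    proof cases
      case 1
      then show ?thesis
        by (intro exI[of _ "mat2 1 0 0 1"] exI[of _ id]) (simp add: S D)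
    next
      case 2
      then show ?thesis
        by (intro exI[of _ "mat2 \<i> 0 0 (- \<i>)"] exI[of _ id])
          (simp add: S D to_PSL2C_eq_iff algebra_simps)
    next
      case 3
      \<comment> \<open>The conjugating matrix is, up to sign, the product of \<open>matS\<close>
        and diag(i, -i).\<close>
      then show ?thesis
        by (intro exI[of _ "mat2 0 (- \<i>) (- \<i>) 0"] exI[of _ cnj_mat])
          (simp add: S D to_PSL2C_eq_iff cnj_omega algebra_simps)
    next
      case 4
      then show ?thesis
        by (intro exI[of _ matS] exI[of _ cnj_mat])
          (simp add: S D to_PSL2C_eq_iff cnj_omega algebra_simps)
    qed
  qed
  then obtain g \<tau> where g: "det g = 1" and \<tau>: "\<tau> = id \<or> \<tau> = cnj_mat"
    and gens: "f matS = to_PSL2C (g ** \<tau> matS ** adj2 g)"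
      "f matD = to_PSL2C (g ** \<tau> matD ** adj2 g)"
      "f (upper 1) = to_PSL2C (g ** \<tau> (upper 1) ** adj2 g)"
    unfolding mem_Collect_eq by blast
  have "f A = to_PSL2C (g ** \<tau> A ** adj2 g)" if "A \<in> G" for A
    using that
  proof (induction A rule: G_induct)
    case (mult A B)
    have "\<tau> (A ** B) = \<tau> A ** \<tau> B" using \<tau> by (auto simp: cnj_mat_mult)
    moreover have "g ** (\<tau> A ** \<tau> B) ** adj2 g = (g ** \<tau> A ** adj2 g) ** (g ** \<tau> B ** adj2 g)"
      using adj2_mult[OF g] by (metis matrix_mul_assoc matrix_mul_rid)
    ultimately show ?case using f_mult_lift[OF mult.hyps mult.IH] by simp
  qed (rule gens)+
  with g \<tau> show ?thesis by (rule that)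
qed

lemma classification:
  assumes inf: "infinite (f ` G)"
  obtains g \<tau> where "det g = 1" "\<tau> = id \<or> \<tau> = cnj_mat"
    "\<And>A. A \<in> G \<Longrightarrow> f A = to_PSL2C (g ** \<tau> A ** adj2 g)"
proof -
  obtain s where s: "det s = 1" "f matS = to_PSL2C s" by (rule f_lift[OF gens_in_G(1)])
  obtain d where d: "det d = 1" "f matD = to_PSL2C d" by (rule f_lift[OF gens_in_G(3)])
  have "f matD \<noteq> f (mat 1)" using inf finite_image_if_D_trivial by blast
  then have d_nontrivial: "d \<noteq> mat 1" "d \<noteq> - mat 1"
    unfolding d(2) f_one to_PSL2C_eq_iff by simp_all
  have SD: "f (matS ** matD) = to_PSL2C (s ** d)"
    by (rule f_mult_lift[OF gens_in_G(1,3) s(2) d(2)])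
  have s2: "s ** s = mat 1 \<or> s ** s = - mat 1"
    by (rule square_lift[OF gens_in_G(1) s(2)]) (simp add: mat_eq_mat2)
  have sd2: "(s ** d) ** (s ** d) = mat 1 \<or> (s ** d) ** (s ** d) = - mat 1"
    by (rule square_lift[OF G_mult[OF gens_in_G(1,3)] SD])
      (simp add: mat_eq_mat2 algebra_simps omega_sq)
  have d3: "d ** d ** d = mat 1 \<or> d ** d ** d = - mat 1"
    by (rule cube_lift[OF gens_in_G(3) d(2)])
      (simp add: mat_eq_mat2 algebra_simps omega_sq omega_sq_mult)
  obtain g where g: "det g = 1" "s ** g = g ** matS" "d ** g = g ** matD \<or> - d ** g = g ** matD"
    by (rule simultaneous_normal_form[OF s(1) d(1) s2 sd2 d3 d_nontrivial])
  define f' where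
    "f' = (\<lambda>A. to_PSL2C (adj2 g) \<otimes>\<^bsub>PSL2C\<^esub> f A \<otimes>\<^bsub>PSL2C\<^esub> to_PSL2C (adj2 (adj2 g)))"
  have adj: "adj2 (adj2 g) = g" "det (adj2 g) = 1"
    by (simp add: adj2_def mat2_collapse, simp add: g(1))
  interpret f': eisenstein_rep \<omega> f'
    unfolding f'_def by (rule conjugate_rep[OF adj(2)])
  have f': "f' A = to_PSL2C (adj2 g ** a ** g)" if "f A = to_PSL2C a" for A a
    unfolding f'_def adj(1) that by (simp add: to_PSL2C_mult)
  have "adj2 g ** s ** g = adj2 g ** g ** matS" by (metis g(2) matrix_mul_assoc)
  then have S': "f' matS = to_PSL2C matS"
    using f'[OF s(2)] adj2_mult[OF g(1)] by (simp only: matrix_mul_lid)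
  have D': "f' matD = to_PSL2C matD"
  proof -
    obtain d' where d': "d' = d \<or> d' = - d" "d' ** g = g ** matD" using g(3) by blast
    have "f matD = to_PSL2C d'" using d'(1) unfolding d(2) to_PSL2C_eq_iff by (elim disjE) simp_all
    then have "f' matD = to_PSL2C (adj2 g ** d' ** g)" by (rule f')
    also have "adj2 g ** d' ** g = adj2 g ** g ** matD" by (metis d'(2) matrix_mul_assoc)
    finally show ?thesis unfolding adj2_mult[OF g(1)] matrix_mul_lid .
  qed
  have f_f': "f A = to_PSL2C (g ** a ** adj2 g)" if A: "A \<in> G" and a: "f' A = to_PSL2C a" for A a
  proof -
    obtain b where b: "f A = to_PSL2C b" by (rule f_lift[OF A])
    have "to_PSL2C (adj2 g ** b ** g) = to_PSL2C a" using f'[OF b] a by simp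
    then have "a = adj2 g ** b ** g \<or> a = - (adj2 g ** b ** g)" by (auto simp: to_PSL2C_eq_iff)
    moreover have "g ** (adj2 g ** b ** g) ** adj2 g = b"
      by (metis g(1) mult_adj2 matrix_mul_assoc matrix_mul_lid matrix_mul_rid)
    ultimately have "g ** a ** adj2 g = b \<or> g ** a ** adj2 g = - b"
      by (elim disjE) (simp_all only: minus_matrix_mult simp_thms)
    then show ?thesis unfolding b to_PSL2C_eq_iff by (elim disjE) simp_all
  qed
  \<comment> \<open>Conjugating back maps the image of \<open>f'\<close> onto that of
    \<open>f\<close>, so infiniteness passes to the normalized representation.\<close>
  have "infinite (f' ` G)"
  proof
    assume "finite (f' ` G)"
    moreover have "f ` G \<subseteq> (\<lambda>C. to_PSL2C g \<otimes>\<^bsub>PSL2C\<^esub> C \<otimes>\<^bsub>PSL2C\<^esub> to_PSL2C (adj2 g)) ` f' ` G"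
    proof
      fix C assume "C \<in> f ` G"
      then obtain A where A: "A \<in> G" "C = f A" by blast
      obtain a where "f' A = to_PSL2C a" by (rule f'.f_lift[OF A(1)])
      then have "C = to_PSL2C g \<otimes>\<^bsub>PSL2C\<^esub> f' A \<otimes>\<^bsub>PSL2C\<^esub> to_PSL2C (adj2 g)"
        using f_f'[OF A(1)] A(2) by (simp add: to_PSL2C_mult)
      then show "C \<in> (\<lambda>C. to_PSL2C g \<otimes>\<^bsub>PSL2C\<^esub> C \<otimes>\<^bsub>PSL2C\<^esub> to_PSL2C (adj2 g)) ` f' ` G"
        using A(1) by blast
    qed
    ultimately show False using inf by (meson finite_imageI finite_subset)
  qed
  then obtain h \<tau> where h: "det h = 1" and \<tau>: "\<tau> = id \<or> \<tau> = cnj_mat"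
    and *: "\<And>A. A \<in> G \<Longrightarrow> f' A = to_PSL2C (h ** \<tau> A ** adj2 h)"
    by (rule f'.normalized_classification[OF S' D']) (rule that)
  have adj_mult: "adj2 (g ** h) = adj2 h ** adj2 g"
    by (cases g rule: mat2_cases; cases h rule: mat2_cases) (simp add: algebra_simps)
  show ?thesis
  proof (rule that[of "g ** h", OF _ \<tau>])
    show "det (g ** h) = 1" by (simp add: det_mul g(1) h)
    fix A assume A: "A \<in> G"
    then show "f A = to_PSL2C ((g ** h) ** \<tau> A ** adj2 (g ** h))"
      using f_f'[OF A *[OF A]] by (simp add: adj_mult matrix_mul_assoc)
  qed
qed

end

section \<open>The trace field\<close>

lemma complex_ring_simps [simp]:
  "carrier complex_ring = UNIV" "x \<otimes>\<^bsub>complex_ring\<^esub> y = x * y" "x \<oplus>\<^bsub>complex_ring\<^esub> y = x + y"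
  "\<zero>\<^bsub>complex_ring\<^esub> = 0" "\<one>\<^bsub>complex_ring\<^esub> = 1"
  by (simp_all add: ring_of_type_algebra_def)

lemma field_complex_ring: "field complex_ring"
  by (rule field_from_type_algebra)

lemma ring_complex_ring: "ring complex_ring"
  by (rule ring_from_type_algebra)

lemma complex_ring_minus [simp]: "\<ominus>\<^bsub>complex_ring\<^esub> x = - x"
  by (rule abelian_group.minus_equality[OF ring.is_abelian_group[OF ring_complex_ring]]) simp_all

lemma complex_ring_inv [simp]: "x \<noteq> 0 \<Longrightarrow> inv\<^bsub>complex_ring\<^esub> x = inverse x"
  by (rule comm_monoid.comm_inv_char
      [OF cring.axioms(2)[OF domain.axioms(1)[OF field.axioms(1)[OF field_complex_ring]]]])
    simp_all

lemma subfield_Rats: "subfield \<rat> complex_ring"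
  by (intro field.subfieldI'[OF field_complex_ring] ring.subringI[OF ring_complex_ring])
    (auto simp: Rats_minus_iff)

lemma Im_Rats:
  assumes "x \<in> \<rat>"
  shows "Im x = 0"
proof -
  obtain a b :: int where "x = of_int a / of_int b" using assms by (rule Rats_cases')
  then have "x = of_real (of_int a / of_int b)" by simp
  then show ?thesis by (simp only: Im_complex_of_real)
qed

context eisenstein
begin

text \<open>The field Q(\<omega>), given by its rational basis 1, \<omega>.\<close>

definition omega_rationals :: "complex set" where
  "omega_rationals = {a + b * \<omega> | a b. a \<in> \<rat> \<and> b \<in> \<rat>}"

lemma omega_rationalsI: "a \<in> \<rat> \<Longrightarrow> b \<in> \<rat> \<Longrightarrow> a + b * \<omega> \<in> omega_rationals"
  unfolding omega_rationals_def by blast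

lemma omega_rationalsE:
  assumes "x \<in> omega_rationals"
  obtains a b where "a \<in> \<rat>" "b \<in> \<rat>" "x = a + b * \<omega>"
  using assms unfolding omega_rationals_def by blast

lemma Rats_omega_independent:
  assumes "a \<in> \<rat>" "b \<in> \<rat>" "a + b * \<omega> = 0"
  shows "a = 0" "b = 0"
proof -
  have Im: "Im a = 0" "Im b = 0" using assms(1,2) by (simp_all add: Im_Rats)
  with arg_cong[OF assms(3), of Im] have "Re b = 0" using Im_omega_nonzero by simp
  with Im show "b = 0" by (simp add: complex_eq_iff)
  with assms(3) show "a = 0" by simp
qed

lemma omega_rationals_inverse:
  assumes "x \<in> omega_rationals" "x \<noteq> 0"
  shows "inverse x \<in> omega_rationals"
proof -
  obtain a b where ab: "a \<in> \<rat>" "b \<in> \<rat>" and x: "x = a + b * \<omega>"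
    using assms(1) by (rule omega_rationalsE)
  \<comment> \<open>The Galois conjugate a + b \<omega>^2 of \<open>x\<close>; the product
    \<open>N\<close> is the norm.\<close>
  define y where "y = (a - b) + (- b) * \<omega>"
  define N where "N = a * a - a * b + b * b"
  have xy: "x * y = N" by (simp add: x y_def N_def algebra_simps omega_sq omega_sq_mult)
  have "y \<noteq> 0"
  proof
    assume "y = 0"
    moreover have "a - b \<in> \<rat>" "- b \<in> \<rat>" using ab by (simp_all add: Rats_minus_iff)
    ultimately have "a - b = 0" "- b = 0"
      unfolding y_def using Rats_omega_independent by blast+
    then show False using assms(2) by (simp add: x)
  qed
  then have "N \<noteq> 0" using xy assms(2) by auto
  then have "inverse x = y / N" using xy assms(2) by (simp add: field_simps)
  also have "\<dots> = (a - b) / N + (- b / N) * \<omega>"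
    by (simp add: y_def diff_divide_distrib)
  also have "\<dots> \<in> omega_rationals"
    unfolding N_def using ab by (intro omega_rationalsI Rats_divide Rats_diff Rats_add Rats_mult) (simp_all add: Rats_minus_iff)
  finally show ?thesis .
qed

lemma SL2_preimage_G: "SL2_preimage (carrier (PSL2 R)) = G"
  by (rule SL2_preimage_PSL2) simp

lemma trace_field_eq: "trace_field (carrier (PSL2 R)) = omega_rationals"
proof -
  define H where "H = trace ` G"
  have "generate_field complex_ring H = omega_rationals"
  proof
    show "generate_field complex_ring H \<subseteq> omega_rationals"
    proof
      fix x assume "x \<in> generate_field complex_ring H"
      then show "x \<in> omega_rationals"
      proof induction
        case one
        show ?case using omega_rationalsI[of 1 0] by simp
      next
        case (incl h)
        then obtain A where "A \<in> G" "h = trace A" unfolding H_def by blast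
        then have "h \<in> R" by (simp add: carrier_SL2 trace_def sum_2)
        then obtain a b where "h = of_int a + of_int b * \<omega>" by (rule R_cases)
        then show ?case by (simp add: omega_rationalsI)
      next
        case (a_inv h)
        from a_inv.IH show ?case
        proof (rule omega_rationalsE)
          fix a b assume "a \<in> \<rat>" "b \<in> \<rat>" "h = a + b * \<omega>"
          then show ?thesis using omega_rationalsI[of "- a" "- b"] by (simp add: Rats_minus_iff)
        qed
      next
        case (m_inv h)
        then show ?case using omega_rationals_inverse by simp
      next
        case (eng_add h k)
        from eng_add.IH show ?case
        proof (elim omega_rationalsE)
          fix a b c d assume "a \<in> \<rat>" "b \<in> \<rat>" "h = a + b * \<omega>" "c \<in> \<rat>" "d \<in> \<rat>" "k = c + d * \<omega>"
          then show ?thesis using omega_rationalsI[of "a + c" "b + d"] by (simp add: algebra_simps)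
        qed
      next
        case (eng_mult h k)
        from eng_mult.IH show ?case
        proof (elim omega_rationalsE)
          fix a b c d assume "a \<in> \<rat>" "b \<in> \<rat>" "h = a + b * \<omega>" "c \<in> \<rat>" "d \<in> \<rat>" "k = c + d * \<omega>"
          then show ?thesis
            using omega_rationalsI[of "a * c - b * d" "a * d + b * c - b * d"]
            by (simp add: algebra_simps omega_sq omega_sq_mult)
        qed
      qed
    qed
  next
    have add: "x + y \<in> generate_field complex_ring H"
      if "x \<in> generate_field complex_ring H" "y \<in> generate_field complex_ring H" for x y
      using generate_field.eng_add[OF that] by simp
    have mult: "x * y \<in> generate_field complex_ring H"
      if "x \<in> generate_field complex_ring H" "y \<in> generate_field complex_ring H" for x y
      using generate_field.eng_mult[OF that] by simp
    have minus: "- x \<in> generate_field complex_ring H" if "x \<in> generate_field complex_ring H" for x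
      using generate_field.a_inv[OF that] by simp
    have one: "1 \<in> generate_field complex_ring H"
      using generate_field.one[of complex_ring H] by simp
    \<comment> \<open>A single trace, 2 + \<omega>, already produces \<omega>; the rationals come
      from 1.\<close>
    have "mat2 (1 + \<omega>) \<omega> 1 1 \<in> G" by simp
    then have "trace (mat2 (1 + \<omega>) \<omega> 1 1) \<in> H" unfolding H_def by blast
    then have "2 + \<omega> \<in> generate_field complex_ring H"
      using generate_field.incl[of "2 + \<omega>" H] by simp
    then have "(2 + \<omega>) + (- 1 + - 1) \<in> generate_field complex_ring H"
      by (rule add) (intro add minus one)
    then have omega: "\<omega> \<in> generate_field complex_ring H" by simp
    have nat: "of_nat n \<in> generate_field complex_ring H" for n
    proof (induction n)
      case 0
      show ?case using add[OF one minus[OF one]] by simp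
    next
      case (Suc n)
      then show ?case using add[OF one] by simp
    qed
    have int: "of_int n \<in> generate_field complex_ring H" for n
      by (cases n rule: int_cases2) (simp_all add: nat minus)
    have rat: "q \<in> generate_field complex_ring H" if q: "q \<in> \<rat>" for q
    proof -
      obtain a b :: int where "b > 0" and q_eq: "q = of_int a / of_int b" using q by (rule Rats_cases')
      then have "(of_int b :: complex) \<noteq> 0" by simp
      then have "inverse (of_int b) \<in> generate_field complex_ring H"
        using generate_field.m_inv[OF int[of b]] by simp
      then show ?thesis unfolding q_eq divide_inverse by (intro mult int)
    qed
    show "omega_rationals \<subseteq> generate_field complex_ring H"
    proof
      fix x assume "x \<in> omega_rationals"
      then obtain a b where "a \<in> \<rat>" "b \<in> \<rat>" "x = a + b * \<omega>" by (rule omega_rationalsE)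
      then show "x \<in> generate_field complex_ring H" using add mult rat omega by simp
    qed
  qed
  then show ?thesis unfolding trace_field_def SL2_preimage_G H_def .
qed

lemma dimension_omega_rationals: "ring.dimension complex_ring 2 \<rat> omega_rationals"
proof -
  interpret ring complex_ring by (rule ring_complex_ring)
  \<comment> \<open>The dimension is built up from the zero space by adjoining the basis vectors 1
    and \<omega> in turn.\<close>
  have "dimension 0 \<rat> {0}" using zero_dim by simp
  then have "dimension (Suc 0) \<rat> (line_extension \<rat> 1 {0})"
    by (intro Suc_dim) simp_all
  moreover have "line_extension \<rat> 1 {0} = \<rat>"
    unfolding set_eq_iff line_extension_mem_iff by simp
  moreover have "\<omega> \<notin> \<rat>"
    using Im_omega_nonzero Im_Rats by blast
  ultimately have "dimension (Suc (Suc 0)) \<rat> (line_extension \<rat> \<omega> \<rat>)"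
    by (intro Suc_dim) simp_all
  moreover have "line_extension \<rat> \<omega> \<rat> = omega_rationals"
    unfolding set_eq_iff line_extension_mem_iff omega_rationals_def
    by (auto simp: add.commute)
  ultimately show ?thesis by (simp add: numeral_2_eq_2)
qed

lemma number_field_trace_field: "number_field (trace_field (carrier (PSL2 R)))"
proof -
  have "subfield (trace_field (carrier (PSL2 R))) complex_ring"
    unfolding trace_field_def
    by (rule field.generate_field_is_subfield[OF field_complex_ring]) simp
  then show ?thesis
    using ring.finite_dimensionI[OF ring_complex_ring dimension_omega_rationals]
    by (simp add: number_field_def trace_field_eq)
qed

lemma field_degree_trace_field: "field_degree (trace_field (carrier (PSL2 R))) = 2"
  using ring.dimI[OF ring_complex_ring subfield_Rats dimension_omega_rationals]
  by (simp add: field_degree_def trace_field_eq over_def)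

end

section \<open>Characters of Zariski-dense representations\<close>

definition conjugate_by :: "('g, 'm) monoid_scheme \<Rightarrow> (complex^2^2) set \<Rightarrow>
    ('g \<Rightarrow> (complex^2^2) set) \<Rightarrow> 'g \<Rightarrow> (complex^2^2) set" where
  "conjugate_by H g \<rho> = (\<lambda>\<gamma>\<in>carrier H. g \<otimes>\<^bsub>PSL2C\<^esub> \<rho> \<gamma> \<otimes>\<^bsub>PSL2C\<^esub> inv\<^bsub>PSL2C\<^esub> g)"

lemma conjugacy_class_eq: "conjugacy_class H \<rho> = (\<lambda>g. conjugate_by H g \<rho>) ` carrier PSL2C"
  by (simp add: conjugacy_class_def conjugate_by_def)

lemma conjugate_by_conjugate_by:
  assumes "g \<in> carrier PSL2C" "h \<in> carrier PSL2C" "\<rho> \<in> carrier H \<rightarrow> carrier PSL2C"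
  shows "conjugate_by H g (conjugate_by H h \<rho>) = conjugate_by H (g \<otimes>\<^bsub>PSL2C\<^esub> h) \<rho>"
proof -
  interpret group PSL2C by (rule group_PSL2C)
  show ?thesis
    unfolding conjugate_by_def
  proof (rule restrict_ext)
    fix \<gamma> assume "\<gamma> \<in> carrier H"
    moreover from this have "\<rho> \<gamma> \<in> carrier PSL2C" using assms(3) by blast
    ultimately show "g \<otimes>\<^bsub>PSL2C\<^esub> (\<lambda>\<gamma>\<in>carrier H. h \<otimes>\<^bsub>PSL2C\<^esub> \<rho> \<gamma> \<otimes>\<^bsub>PSL2C\<^esub> inv\<^bsub>PSL2C\<^esub> h) \<gamma> \<otimes>\<^bsub>PSL2C\<^esub>
        inv\<^bsub>PSL2C\<^esub> g = g \<otimes>\<^bsub>PSL2C\<^esub> h \<otimes>\<^bsub>PSL2C\<^esub> \<rho> \<gamma> \<otimes>\<^bsub>PSL2C\<^esub> inv\<^bsub>PSL2C\<^esub> (g \<otimes>\<^bsub>PSL2C\<^esub> h)"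
      using assms(1,2) by (simp add: m_assoc inv_mult_group)
  qed
qed

text \<open>Right translation by \<open>h\<close> permutes PSL(2,C), so both orbits run through the
  same conjugates.\<close>

lemma conjugacy_class_conjugate_by:
  assumes h: "h \<in> carrier PSL2C" and \<rho>: "\<rho> \<in> carrier H \<rightarrow> carrier PSL2C"
  shows "conjugacy_class H (conjugate_by H h \<rho>) = conjugacy_class H \<rho>"
proof -
  interpret group PSL2C by (rule group_PSL2C)
  have "(\<lambda>g. conjugate_by H g (conjugate_by H h \<rho>)) ` carrier PSL2C
      = (\<lambda>g. conjugate_by H g \<rho>) ` (\<lambda>g. g \<otimes>\<^bsub>PSL2C\<^esub> h) ` carrier PSL2C"
    unfolding image_image
    by (rule image_cong[OF refl]) (rule conjugate_by_conjugate_by[OF _ h \<rho>])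
  also have "(\<lambda>g. g \<otimes>\<^bsub>PSL2C\<^esub> h) ` carrier PSL2C = carrier PSL2C"
  proof
    show "(\<lambda>g. g \<otimes>\<^bsub>PSL2C\<^esub> h) ` carrier PSL2C \<subseteq> carrier PSL2C"
      using h by (intro image_subsetI m_closed)
    show "carrier PSL2C \<subseteq> (\<lambda>g. g \<otimes>\<^bsub>PSL2C\<^esub> h) ` carrier PSL2C"
    proof
      fix x assume x: "x \<in> carrier PSL2C"
      show "x \<in> (\<lambda>g. g \<otimes>\<^bsub>PSL2C\<^esub> h) ` carrier PSL2C"
        by (rule image_eqI[of _ _ "x \<otimes>\<^bsub>PSL2C\<^esub> inv\<^bsub>PSL2C\<^esub> h"]) (use x h in \<open>simp_all add: m_assoc\<close>)
    qed
  qed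
  finally show ?thesis by (simp only: conjugacy_class_eq)
qed

lemma sq_trace_conjugate:
  assumes "g \<in> carrier PSL2C" "C \<in> carrier PSL2C"
  shows "sq_trace (g \<otimes>\<^bsub>PSL2C\<^esub> C \<otimes>\<^bsub>PSL2C\<^esub> inv\<^bsub>PSL2C\<^esub> g) = sq_trace C"
proof -
  obtain a where a: "det a = 1" "g = to_PSL2C a" using assms(1) by (rule PSL2C_cases)
  obtain c where c: "C = to_PSL2C c" using assms(2) by (rule PSL2C_cases)
  show ?thesis
    by (simp add: a c to_PSL2C_inv to_PSL2C_mult sq_trace_to_PSL2C trace_conj)
qed

lemma character_conjugate_by:
  assumes "h \<in> carrier PSL2C" "\<rho> \<in> carrier H \<rightarrow> carrier PSL2C"
  shows "character H (conjugate_by H h \<rho>) = character H \<rho>"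
  unfolding character_def conjugate_by_def
proof (rule restrict_ext)
  fix \<gamma> assume \<gamma>: "\<gamma> \<in> carrier H"
  then have "\<rho> \<gamma> \<in> carrier PSL2C" using assms(2) by blast
  then show "sq_trace ((\<lambda>\<gamma>\<in>carrier H. h \<otimes>\<^bsub>PSL2C\<^esub> \<rho> \<gamma> \<otimes>\<^bsub>PSL2C\<^esub> inv\<^bsub>PSL2C\<^esub> h) \<gamma>) = sq_trace (\<rho> \<gamma>)"
    using sq_trace_conjugate[OF assms(1)] \<gamma> by simp
qed

section \<open>The inclusion and its complex conjugate\<close>

context eisenstein
begin

abbreviation \<Gamma> where "\<Gamma> \<equiv> PSL2 R"

abbreviation inclusion where "inclusion \<equiv> (\<lambda>\<gamma>\<in>carrier \<Gamma>. \<gamma>)"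

lemma to_PSL2C_in_Gamma: "A \<in> G \<Longrightarrow> to_PSL2C A \<in> carrier \<Gamma>"
  unfolding PSL2_carrier by (rule imageI)

lemma G_det: "A \<in> G \<Longrightarrow> det A = 1"
  by (simp add: carrier_SL2)

lemma carrier_Gamma_subset: "carrier \<Gamma> \<subseteq> carrier PSL2C"
  unfolding PSL2_carrier using G_det by (intro image_mono subsetI) simp

lemma cnj_mat_G: "A \<in> G \<Longrightarrow> cnj_mat A \<in> G"
  by (simp add: carrier_SL2 det_cnj_mat) (simp add: cnj_mat_def)

lemma complex_conjugate_inclusion:
  assumes "A \<in> G"
  shows "complex_conjugate \<Gamma> inclusion (to_PSL2C A) = to_PSL2C (cnj_mat A)"
  using to_PSL2C_in_Gamma[OF assms]
  by (simp add: complex_conjugate_def flip: cnj_mat_def) (simp add: to_PSL2C_eq cnj_mat_minus)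

text \<open>An involution of \<open>G\<close> is onto, so the image of \<rho> is all of \<Gamma>;
  its preimage is \<open>G\<close>, which contains SL(2,Z). The identity and \<open>cnj_mat\<close>
  are the two instances needed.\<close>

lemma zar_repsI:
  assumes "\<And>A. A \<in> G \<Longrightarrow> \<rho> (to_PSL2C A) = to_PSL2C (\<tau> A)" "\<rho> \<in> extensional (carrier \<Gamma>)"
    and \<tau>: "\<And>A. A \<in> G \<Longrightarrow> \<tau> A \<in> G" "\<And>A. A \<in> G \<Longrightarrow> \<tau> (\<tau> A) = A"
    "\<And>A B. A \<in> G \<Longrightarrow> B \<in> G \<Longrightarrow> \<tau> (A ** B) = \<tau> A ** \<tau> B"
  shows "\<rho> \<in> zar_reps \<Gamma>"
proof -
  have "\<rho> \<in> hom \<Gamma> PSL2C"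
  proof (rule homI)
    fix x assume "x \<in> carrier \<Gamma>"
    then obtain A where A: "A \<in> G" "x = to_PSL2C A" unfolding PSL2_carrier by blast
    then have "\<rho> x = to_PSL2C (\<tau> A)" using assms(1) by simp
    then show "\<rho> x \<in> carrier PSL2C"
      using to_PSL2C_in_Gamma[OF \<tau>(1)[OF A(1)]] carrier_Gamma_subset by auto
    fix y assume "y \<in> carrier \<Gamma>"
    then obtain B where B: "B \<in> G" "y = to_PSL2C B" unfolding PSL2_carrier by blast
    show "\<rho> (x \<otimes>\<^bsub>\<Gamma>\<^esub> y) = \<rho> x \<otimes>\<^bsub>PSL2C\<^esub> \<rho> y"
      using assms(1)[OF A(1)] assms(1)[OF B(1)] assms(1)[OF G_mult[OF A(1) B(1)]] \<tau>(3)[OF A(1) B(1)]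
      by (simp add: A(2) B(2) to_PSL2C_mult)
  qed
  moreover have "\<rho> ` carrier \<Gamma> = carrier \<Gamma>"
  proof -
    have "\<rho> ` carrier \<Gamma> = to_PSL2C ` \<tau> ` G"
      unfolding PSL2_carrier image_image using assms(1) by (rule image_cong[OF refl])
    moreover have "\<tau> ` G = G"
    proof
      show "G \<subseteq> \<tau> ` G" using \<tau>(1,2) by (metis image_eqI subsetI)
    qed (use \<tau>(1) in blast)
    ultimately show ?thesis by (simp add: PSL2_carrier)
  qed
  moreover have "zariski_dense G"
  proof (rule zariski_dense_if_contains_SL2Z)
    have "\<int> \<subseteq> R" by (auto elim: Ints_cases)
    then show "carrier (SL2 \<int>) \<subseteq> G" by (auto simp: carrier_SL2)
  qed (auto simp: carrier_SL2)
  ultimately show ?thesis using assms(2) by (simp add: zar_reps_def SL2_preimage_G)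
qed

lemma inclusion_zar_rep: "inclusion \<in> zar_reps \<Gamma>"
proof (rule zar_repsI[of _ "\<lambda>A. A"])
  show "inclusion (to_PSL2C A) = to_PSL2C A" if "A \<in> G" for A
    using to_PSL2C_in_Gamma[OF that] by simp
qed simp_all

lemma conjugate_zar_rep: "complex_conjugate \<Gamma> inclusion \<in> zar_reps \<Gamma>"
proof (rule zar_repsI[of _ cnj_mat])
  show "complex_conjugate \<Gamma> inclusion \<in> extensional (carrier \<Gamma>)"
    by (simp add: complex_conjugate_def)
qed (simp_all add: complex_conjugate_inclusion cnj_mat_G cnj_mat_mult)

lemma zar_reps_Pi: "\<rho> \<in> zar_reps \<Gamma> \<Longrightarrow> \<rho> \<in> carrier \<Gamma> \<rightarrow> carrier PSL2C"
  by (simp add: zar_reps_def hom_def)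

text \<open>Density rules out a finite image, so \<open>classification\<close> applies to the
  pullback of \<rho> to matrices. Extensionality turns agreement on \<Gamma> into equality of
  functions.\<close>

lemma zar_reps_classification:
  assumes "\<rho> \<in> zar_reps \<Gamma>"
  obtains h \<sigma> where "h \<in> carrier PSL2C" "\<rho> = conjugate_by \<Gamma> h \<sigma>"
    "\<sigma> = inclusion \<or> \<sigma> = complex_conjugate \<Gamma> inclusion"
proof -
  define f where "f A = \<rho> (to_PSL2C A)" for A
  have hom: "\<rho> \<in> hom \<Gamma> PSL2C" and ext: "\<rho> \<in> extensional (carrier \<Gamma>)"
    and dense: "zariski_dense (SL2_preimage (\<rho> ` carrier \<Gamma>))"
    using assms by (simp_all add: zar_reps_def)
  interpret eisenstein_rep \<omega> f
  proof unfold_locales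
    fix A assume A: "A \<in> G"
    then show "f A \<in> carrier PSL2C"
      unfolding f_def by (intro hom_in_carrier[OF hom] to_PSL2C_in_Gamma)
    fix B assume "B \<in> G"
    then show "f (A ** B) = f A \<otimes>\<^bsub>PSL2C\<^esub> f B"
      using hom_mult[OF hom] A to_PSL2C_in_Gamma to_PSL2C_mult unfolding f_def by metis
  qed (simp add: f_def)
  have image: "f ` G = \<rho> ` carrier \<Gamma>"
    unfolding PSL2_carrier image_image f_def ..
  have "infinite (f ` G)"
  proof
    assume "finite (f ` G)"
    moreover have "f ` G \<subseteq> carrier PSL2C" using f_carrier by blast
    ultimately show False using dense finite_image_not_zariski_dense unfolding image by blast
  qed
  then obtain g \<tau> where g: "det g = 1" and \<tau>: "\<tau> = id \<or> \<tau> = cnj_mat"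
    and f: "\<And>A. A \<in> G \<Longrightarrow> f A = to_PSL2C (g ** \<tau> A ** adj2 g)"
    by (rule classification) (rule that)
  obtain \<sigma> where \<sigma>: "\<sigma> = inclusion \<or> \<sigma> = complex_conjugate \<Gamma> inclusion"
    "\<And>A. A \<in> G \<Longrightarrow> \<sigma> (to_PSL2C A) = to_PSL2C (\<tau> A)"
  proof (cases "\<tau> = id")
    case True
    then show ?thesis by (intro that[of inclusion]) (simp_all add: to_PSL2C_in_Gamma)
  next
    case False
    then show ?thesis using \<tau>
      by (intro that[of "complex_conjugate \<Gamma> inclusion"]) (simp_all add: complex_conjugate_inclusion)
  qed
  have "\<rho> = conjugate_by \<Gamma> (to_PSL2C g) \<sigma>"
  proof (rule extensionalityI[OF ext])
    show "conjugate_by \<Gamma> (to_PSL2C g) \<sigma> \<in> extensional (carrier \<Gamma>)"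
      by (simp add: conjugate_by_def)
    fix x assume x: "x \<in> carrier \<Gamma>"
    then obtain A where A: "A \<in> G" "x = to_PSL2C A" unfolding PSL2_carrier by blast
    have "\<rho> x = to_PSL2C (g ** \<tau> A ** adj2 g)" using f[OF A(1)] by (simp add: f_def A(2))
    also have "\<dots> = conjugate_by \<Gamma> (to_PSL2C g) \<sigma> x"
      using x \<sigma>(2)[OF A(1)] g by (simp add: conjugate_by_def A(2) to_PSL2C_inv to_PSL2C_mult)
    finally show "\<rho> x = conjugate_by \<Gamma> (to_PSL2C g) \<sigma> x" .
  qed
  moreover have "to_PSL2C g \<in> carrier PSL2C" unfolding PSL2_carrier using g by (intro imageI) simp
  ultimately show ?thesis using that \<sigma>(1) by blast
qed

text \<open>An element with non-real squared trace separates them: the trace 2 + \<omega> has square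
  3 + 3 \<omega>, whose conjugate is -3 \<omega>.\<close>

lemma characters_distinct:
  "character \<Gamma> inclusion \<noteq> character \<Gamma> (complex_conjugate \<Gamma> inclusion)"
proof
  define A where "A = mat2 (1 + \<omega>) \<omega> 1 1"
  have A: "A \<in> G" by (simp add: A_def)
  assume "character \<Gamma> inclusion = character \<Gamma> (complex_conjugate \<Gamma> inclusion)"
  then have "character \<Gamma> inclusion (to_PSL2C A)
      = character \<Gamma> (complex_conjugate \<Gamma> inclusion) (to_PSL2C A)" by simp
  then have "(trace A)\<^sup>2 = (trace (cnj_mat A))\<^sup>2"
    using to_PSL2C_in_Gamma[OF A]
    by (simp add: character_def complex_conjugate_inclusion[OF A] sq_trace_to_PSL2C)
  then have "3 * (1 + 2 * \<omega>) = 0"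
    by (simp add: A_def cnj_omega power2_eq_square algebra_simps omega_sq)
  then show False using Im_omega_nonzero by (simp add: complex_eq_iff)
qed

section \<open>Counting classes and Galois rigidity\<close>

lemma subgroup_Gamma: "subgroup (carrier \<Gamma>) PSL2C"
proof (rule group.subgroupI[OF group_PSL2C carrier_Gamma_subset])
  show "carrier \<Gamma> \<noteq> {}" using to_PSL2C_in_Gamma[OF gens_in_G(1)] by blast
next
  fix x assume "x \<in> carrier \<Gamma>"
  then obtain A where A: "A \<in> G" "x = to_PSL2C A" unfolding PSL2_carrier by blast
  have "adj2 A \<in> G" using A(1) by (cases A rule: mat2_cases) (simp add: mult.commute)
  then show "inv\<^bsub>PSL2C\<^esub> x \<in> carrier \<Gamma>"
    using to_PSL2C_in_Gamma A G_det by (simp add: to_PSL2C_inv)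
next
  fix x y assume "x \<in> carrier \<Gamma>" "y \<in> carrier \<Gamma>"
  then show "x \<otimes>\<^bsub>PSL2C\<^esub> y \<in> carrier \<Gamma>"
    unfolding PSL2_carrier using G_mult by (auto simp: to_PSL2C_mult)
qed

lemma generators:
  "generate PSL2C {to_PSL2C matS, to_PSL2C (upper 1), to_PSL2C matD} = carrier \<Gamma>"
    (is "generate _ ?S = _")
proof
  have "?S \<subseteq> carrier \<Gamma>" using gens_in_G to_PSL2C_in_Gamma by blast
  then show "generate PSL2C ?S \<subseteq> carrier \<Gamma>"
    by (rule group.generate_subgroup_incl[OF group_PSL2C _ subgroup_Gamma])
  have "to_PSL2C A \<in> generate PSL2C ?S" if "A \<in> G" for A
    using that
  proof (induction A rule: G_induct)
    case (mult A B)
    then show ?case using generate.eng[of "to_PSL2C A" PSL2C ?S "to_PSL2C B"]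
      by (simp only: to_PSL2C_mult)
  qed (rule generate.incl, blast)+
  then show "carrier \<Gamma> \<subseteq> generate PSL2C ?S" unfolding PSL2_carrier by blast
qed

lemma X_zar_Gamma:
  "X_zar \<Gamma> = {conjugacy_class \<Gamma> inclusion, conjugacy_class \<Gamma> (complex_conjugate \<Gamma> inclusion)}"
proof
  show "X_zar \<Gamma> \<subseteq> {conjugacy_class \<Gamma> inclusion, conjugacy_class \<Gamma> (complex_conjugate \<Gamma> inclusion)}"
  proof
    fix Y assume "Y \<in> X_zar \<Gamma>"
    then obtain \<rho> where \<rho>: "\<rho> \<in> zar_reps \<Gamma>" "Y = conjugacy_class \<Gamma> \<rho>"
      unfolding X_zar_def by blast
    from \<rho>(1) obtain h \<sigma> where h: "h \<in> carrier PSL2C" "\<rho> = conjugate_by \<Gamma> h \<sigma>"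
      and \<sigma>: "\<sigma> = inclusion \<or> \<sigma> = complex_conjugate \<Gamma> inclusion"
      by (rule zar_reps_classification)
    have "\<sigma> \<in> carrier \<Gamma> \<rightarrow> carrier PSL2C"
      using \<sigma> zar_reps_Pi inclusion_zar_rep conjugate_zar_rep by blast
    then have "Y = conjugacy_class \<Gamma> \<sigma>"
      unfolding \<rho>(2) h(2) by (rule conjugacy_class_conjugate_by[OF h(1)])
    then show "Y \<in> {conjugacy_class \<Gamma> inclusion, conjugacy_class \<Gamma> (complex_conjugate \<Gamma> inclusion)}"
      using \<sigma> by blast
  qed
next
  show "{conjugacy_class \<Gamma> inclusion, conjugacy_class \<Gamma> (complex_conjugate \<Gamma> inclusion)} \<subseteq> X_zar \<Gamma>"
    unfolding X_zar_def using inclusion_zar_rep conjugate_zar_rep by blast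
qed

text \<open>The character is constant along a conjugacy class, so equal classes would give equal
  characters.\<close>

lemma conjugacy_classes_distinct:
  "conjugacy_class \<Gamma> inclusion \<noteq> conjugacy_class \<Gamma> (complex_conjugate \<Gamma> inclusion)"
proof
  let ?c = "complex_conjugate \<Gamma> inclusion"
  assume eq: "conjugacy_class \<Gamma> inclusion = conjugacy_class \<Gamma> ?c"
  have one: "\<one>\<^bsub>PSL2C\<^esub> \<in> carrier PSL2C"
    by (rule monoid.one_closed[OF group.is_monoid[OF group_PSL2C]])
  then have "conjugate_by \<Gamma> \<one>\<^bsub>PSL2C\<^esub> inclusion \<in> conjugacy_class \<Gamma> inclusion"
    unfolding conjugacy_class_eq by (rule imageI)
  then obtain g where "g \<in> carrier PSL2C" "conjugate_by \<Gamma> \<one>\<^bsub>PSL2C\<^esub> inclusion = conjugate_by \<Gamma> g ?c"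
    unfolding eq unfolding conjugacy_class_eq by blast
  then have "character \<Gamma> inclusion = character \<Gamma> ?c"
    using character_conjugate_by one zar_reps_Pi inclusion_zar_rep conjugate_zar_rep by metis
  then show False using characters_distinct by blast
qed

lemma characters:
  "character \<Gamma> ` zar_reps \<Gamma> =
     {character \<Gamma> inclusion, character \<Gamma> (complex_conjugate \<Gamma> inclusion)}"
proof
  show "character \<Gamma> ` zar_reps \<Gamma> \<subseteq>
      {character \<Gamma> inclusion, character \<Gamma> (complex_conjugate \<Gamma> inclusion)}"
  proof
    fix Y assume "Y \<in> character \<Gamma> ` zar_reps \<Gamma>"
    then obtain \<rho> where \<rho>: "\<rho> \<in> zar_reps \<Gamma>" "Y = character \<Gamma> \<rho>" by blast
    from \<rho>(1) obtain h \<sigma> where h: "h \<in> carrier PSL2C" "\<rho> = conjugate_by \<Gamma> h \<sigma>"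
      and \<sigma>: "\<sigma> = inclusion \<or> \<sigma> = complex_conjugate \<Gamma> inclusion"
      by (rule zar_reps_classification)
    have "\<sigma> \<in> carrier \<Gamma> \<rightarrow> carrier PSL2C"
      using \<sigma> zar_reps_Pi inclusion_zar_rep conjugate_zar_rep by blast
    then have "Y = character \<Gamma> \<sigma>"
      unfolding \<rho>(2) h(2) by (rule character_conjugate_by[OF h(1)])
    then show "Y \<in> {character \<Gamma> inclusion, character \<Gamma> (complex_conjugate \<Gamma> inclusion)}"
      using \<sigma> by blast
  qed
next
  show "{character \<Gamma> inclusion, character \<Gamma> (complex_conjugate \<Gamma> inclusion)} \<subseteq>
      character \<Gamma> ` zar_reps \<Gamma>"
    using inclusion_zar_rep conjugate_zar_rep by blast
qed

lemma galois_rigid_Gamma: "galois_rigid (carrier \<Gamma>)"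
proof -
  \<comment> \<open>The subgroup with the structure inherited from PSL(2,C) is \<Gamma> itself, so
    the count in \<open>X_zar_Gamma\<close> is the one that rigidity asks for.\<close>
  have \<Gamma>: "PSL2C\<lparr>carrier := carrier \<Gamma>\<rparr> = \<Gamma>"
    unfolding PSL2_carrier by (rule PSL2_eq[symmetric])
  have "inclusion ` carrier \<Gamma> = carrier \<Gamma>" by auto
  then have "zariski_dense (SL2_preimage (carrier \<Gamma>))"
    using inclusion_zar_rep by (simp add: zar_reps_def)
  moreover have "\<exists>S. finite S \<and> S \<subseteq> carrier \<Gamma> \<and> generate PSL2C S = carrier \<Gamma>"
    using generators gens_in_G to_PSL2C_in_Gamma
    by (intro exI[of _ "{to_PSL2C matS, to_PSL2C (upper 1), to_PSL2C matD}"]) blast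
  moreover have "finite (X_zar \<Gamma>)" by (simp add: X_zar_Gamma)
  moreover have "card (X_zar \<Gamma>) = 2" unfolding X_zar_Gamma using conjugacy_classes_distinct by simp
  ultimately show ?thesis
    unfolding galois_rigid_def \<Gamma>
    using subgroup_Gamma number_field_trace_field field_degree_trace_field by simp
qed

end

theorem theorem6p1:
  fixes \<omega> :: complex
  assumes "\<omega>\<^sup>2 + \<omega> + 1 = 0"
  defines "\<Gamma> \<equiv> PSL2 (int_adjoin \<omega>)"
  defines "\<iota> \<equiv> (\<lambda>\<gamma>\<in>carrier \<Gamma>. \<gamma>)"
  shows "\<iota> \<in> zar_reps \<Gamma> \<and> complex_conjugate \<Gamma> \<iota> \<in> zar_reps \<Gamma> \<and>
    character \<Gamma> ` zar_reps \<Gamma> = {character \<Gamma> \<iota>, character \<Gamma> (complex_conjugate \<Gamma> \<iota>)} \<and>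
    character \<Gamma> \<iota> \<noteq> character \<Gamma> (complex_conjugate \<Gamma> \<iota>) \<and>
    galois_rigid (carrier \<Gamma>)"
proof -
  interpret eisenstein \<omega> by unfold_locales (rule assms(1))
  show ?thesis
    unfolding \<Gamma>_def \<iota>_def
    by (intro conjI inclusion_zar_rep conjugate_zar_rep characters characters_distinct
        galois_rigid_Gamma)
qed

end
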